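(* There exists a collection $\mathcal{G}$ of pairwise non-isomorphic groups with the following properties: (i) each $G\in\mathcal{G}$ is an irreducible subgroup of $\mathrm{PL}_o([0,1])$ generated by 3 elements; (ii) for each $G\in\mathcal{G}$ the characters $\chi_\ell$, $\chi_r$ of $G$ are independent and have ranks $1$ and $2$, respectively; (iii) for each $G\in\mathcal{G}$ the character $\chi_\ell$ satisfies $\chi_\ell\circ\alpha=\chi_\ell$ for every automorphism $\alpha$ of $G$; (iv) the cardinality of $\mathcal{G}$ is that of the continuum.
   Context: $\mathrm{PL}_o([0,1])$ is the group of orientation preserving piecewise linear homeomorphisms (with finitely many break points) of $[0,1]$. A subgroup $G$ of $\mathrm{PL}_o([0,1])$ is irreducible if no point of $]0,1[$ is fixed by all elements of $G$. The characters $\chi_\ell,\chi_r\colon G\to\mathbb{R}$ are $\chi_\ell(g)=\ln g'(0^+)$ and $\chi_r(g)=\ln g'(1^-)$ (logarithms of the right derivative at $0$ and of the left derivative at $1$). They are called independent if $G=\ker\chi_\ell\cdot\ker\chi_r$. The rank of a character is the rank of its image as an abelian group. *)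

theory Defs
  imports "HOL-Analysis.Analysis" "HOL-Algebra.Bij" "HOL-Algebra.Generated_Groups"
begin

text \<open>\<open>B\<close> contains all break points: \<open>f\<close> is affine on every closed interval whose
  interior does not meet the finite set \<open>B\<close>.\<close>
definition piecewise_linear :: "(real \<Rightarrow> real) \<Rightarrow> bool" where
  "piecewise_linear f \<longleftrightarrow>
     (\<exists>B. finite B \<and>
       (\<forall>x y. 0 \<le> x \<and> x < y \<and> y \<le> 1 \<and> {x<..<y} \<inter> B = {}
          \<longrightarrow> (\<exists>a b. \<forall>t\<in>{x..y}. f t = a * t + b)))"

text \<open>As in the library's group of bijections of a set, elements are functions that are
  undefined outside the unit interval, so that each homeomorphism of the interval is
  represented exactly once. The product is \<open>(g, f) \<mapsto> g \<circ> f\<close>.\<close>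
definition PL\<^sub>o :: "(real \<Rightarrow> real) monoid" where
  "PL\<^sub>o = BijGroup {0..1}
     \<lparr>carrier := {f \<in> extensional {0..1}.
        (\<exists>g. homeomorphism {0..1} {0..1} f g) \<and> strict_mono_on {0..1} f \<and> piecewise_linear f}\<rparr>"

lemma subgroup_PL\<^sub>o: "subgroup (carrier PL\<^sub>o) (BijGroup {0..1})"
proof -
  interpret group "BijGroup {0..1::real}" by (rule group_BijGroup)
  have Bij: "f \<in> Bij {0..1}" if "f \<in> carrier PL\<^sub>o" for f
    using that by (auto simp: PL\<^sub>o_def Bij_def bij_betw_def homeomorphism_def intro!: inj_on_inverseI)
  have inv: "restrict (inv_into {0..1} f) {0..1} \<in> carrier PL\<^sub>o" if f: "f \<in> carrier PL\<^sub>o" for f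
  proof -
    let ?h = "restrict (inv_into {0..1} f) {0..1}"
    obtain g where g: "homeomorphism {0..1} {0..1} f g" and m: "strict_mono_on {0..1} f"
      and pl: "piecewise_linear f" using f by (auto simp: PL\<^sub>o_def)
    have fg: "f ` {0..1} = {0..1}" "g ` {0..1} = {0..1}"
      and gf: "\<And>x. x \<in> {0..1} \<Longrightarrow> g (f x) = x" "\<And>x. x \<in> {0..1} \<Longrightarrow> f (g x) = x"
      using g by (auto simp: homeomorphism_def)
    have gin: "g x \<in> {0..1}" and fin: "f x \<in> {0..1}" if "x \<in> {0..1}" for x
      using fg that by blast+
    have inj: "inj_on f {0..1}" by (rule inj_on_inverseI[of _ g]) (rule gf(1))
    have hg: "?h x = g x" if "x \<in> {0..1}" for x
      using that inv_into_f_eq[OF inj gin[OF that] gf(2)[OF that]] by simp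
    have mg: "g x < g y" if "x \<in> {0..1}" "y \<in> {0..1}" "x < y" for x y
    proof (rule ccontr)
      assume "\<not> g x < g y"
      then have "f (g y) \<le> f (g x)"
        using strict_mono_on_leD[OF m gin[OF that(2)] gin[OF that(1)]] by simp
      then show False using that gf(2) by fastforce
    qed
    have "homeomorphism {0..1} {0..1} ?h f"
      using homeomorphism_cong[OF homeomorphism_symD[OF g], of "{0..1}" "{0..1}" ?h f] hg by blast
    moreover have "strict_mono_on {0..1} ?h"
      using mg by (auto simp: strict_mono_on_def hg simp del: restrict_apply)
    moreover have "piecewise_linear ?h"
    proof -
      obtain B where B: "finite B" "\<And>x y. \<lbrakk>0 \<le> x; x < y; y \<le> 1; {x<..<y} \<inter> B = {}\<rbrakk>
          \<Longrightarrow> \<exists>a b. \<forall>t\<in>{x..y}. f t = a * t + b"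
        using pl unfolding piecewise_linear_def by blast
      have "\<exists>a b. \<forall>t\<in>{x..y}. ?h t = a * t + b"
        if xy: "0 \<le> x" "x < y" "y \<le> 1" "{x<..<y} \<inter> f ` (B \<inter> {0..1}) = {}" for x y
      proof -
        have in01: "x \<in> {0..1}" "y \<in> {0..1}" using xy by auto
        have lt: "g x < g y" using mg in01 xy by blast
        have "s \<notin> B" if s: "s \<in> {g x<..<g y}" for s
        proof
          assume "s \<in> B"
          have s01: "s \<in> {0..1}" using s gin[OF in01(1)] gin[OF in01(2)] by auto
          have "f (g x) < f s" "f s < f (g y)"
            using s m s01 gin in01 by (auto simp: strict_mono_on_def)
          then have "f s \<in> {x<..<y}" using gf(2) in01 by auto
          then show False using xy(4) \<open>s \<in> B\<close> s01 by blast
        qed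
        then obtain a b where ab: "\<And>s. s \<in> {g x..g y} \<Longrightarrow> f s = a * s + b"
          using B(2)[of "g x" "g y"] lt gin[OF in01(1)] gin[OF in01(2)] by fastforce
        have a: "a \<noteq> 0"
        proof
          assume "a = 0"
          then have "f (g x) = f (g y)" using ab lt by auto
          then show False using gf(2) in01 xy(2) by auto
        qed
        have "?h t = (1 / a) * t + (- b / a)" if t: "t \<in> {x..y}" for t
        proof -
          have t01: "t \<in> {0..1}" using t in01 by auto
          have "g t \<in> {g x..g y}"
            using t mg[OF in01(1) t01] mg[OF t01 in01(2)] by (cases "t = x"; cases "t = y") auto
          then have "t = a * g t + b" using ab gf(2)[OF t01] by fastforce
          then have "g t = (t - b) / a" using a by (simp add: field_simps)
          then show ?thesis using hg[OF t01] by (simp add: diff_divide_distrib)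
        qed
        then show ?thesis by blast
      qed
      then show ?thesis
        unfolding piecewise_linear_def using B(1)
        by (intro exI[of _ "f ` (B \<inter> {0..1})"]) blast
    qed
    ultimately show ?thesis unfolding PL\<^sub>o_def by auto
  qed
  have mult: "compose {0..1} f g \<in> carrier PL\<^sub>o"
    if f: "f \<in> carrier PL\<^sub>o" and g: "g \<in> carrier PL\<^sub>o" for f g
  proof -
    let ?c = "compose {0..1} f g"
    obtain f' g' where h: "homeomorphism {0..1} {0..1} f f'" "homeomorphism {0..1} {0..1} g g'"
      and m: "strict_mono_on {0..1} f" "strict_mono_on {0..1} g"
      and pl: "piecewise_linear f" "piecewise_linear g" using f g by (auto simp: PL\<^sub>o_def)
    have ceq: "?c x = (f \<circ> g) x" if "x \<in> {0..1}" for x using that by (simp add: compose_eq)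
    have gin: "g x \<in> {0..1}" if "x \<in> {0..1}" for x
      using h(2) that unfolding homeomorphism_def by blast
    have injg: "inj_on g {0..1}" using m(2) strict_mono_on_imp_inj_on by blast
    have "homeomorphism {0..1} {0..1} ?c (g' \<circ> f')"
      using homeomorphism_cong[OF homeomorphism_compose[OF h(2) h(1)], of "{0..1}" "{0..1}" ?c "g' \<circ> f'"]
        ceq by blast
    moreover have "strict_mono_on {0..1} ?c"
      using m gin by (auto simp: strict_mono_on_def compose_eq)
    moreover have "piecewise_linear ?c"
    proof -
      obtain B where B: "finite B" "\<And>x y. \<lbrakk>0 \<le> x; x < y; y \<le> 1; {x<..<y} \<inter> B = {}\<rbrakk>
          \<Longrightarrow> \<exists>a b. \<forall>t\<in>{x..y}. f t = a * t + b"
        using pl(1) unfolding piecewise_linear_def by blast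
      obtain C where C: "finite C" "\<And>x y. \<lbrakk>0 \<le> x; x < y; y \<le> 1; {x<..<y} \<inter> C = {}\<rbrakk>
          \<Longrightarrow> \<exists>a b. \<forall>t\<in>{x..y}. g t = a * t + b"
        using pl(2) unfolding piecewise_linear_def by blast
      let ?D = "C \<union> (g -` B \<inter> {0..1})"
      have "\<exists>a b. \<forall>t\<in>{x..y}. ?c t = a * t + b"
        if xy: "0 \<le> x" "x < y" "y \<le> 1" "{x<..<y} \<inter> ?D = {}" for x y
      proof -
        have in01: "x \<in> {0..1}" "y \<in> {0..1}" using xy by auto
        have lt: "g x < g y" using m(2) in01 xy by (auto simp: strict_mono_on_def)
        obtain a b where ab: "\<And>t. t \<in> {x..y} \<Longrightarrow> g t = a * t + b"
          using C(2)[OF xy(1-3)] xy(4) by blast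
        have "s \<notin> B" if s: "s \<in> {g x<..<g y}" for s
        proof
          assume "s \<in> B"
          have "s \<in> g ` {0..1}"
            using s gin[OF in01(1)] gin[OF in01(2)] h(2) by (auto simp: homeomorphism_def)
          then obtain u where u: "u \<in> {0..1}" "s = g u" by blast
          have "x < u" "u < y"
            using s u strict_mono_on_less[OF m(2)] in01 by auto
          then show False using xy(4) u \<open>s \<in> B\<close> by auto
        qed
        then obtain c d where cd: "\<And>s. s \<in> {g x..g y} \<Longrightarrow> f s = c * s + d"
          using B(2)[of "g x" "g y"] lt gin[OF in01(1)] gin[OF in01(2)] by fastforce
        have "?c t = (c * a) * t + (c * b + d)" if t: "t \<in> {x..y}" for t
        proof -
          have t01: "t \<in> {0..1}" using t in01 by auto
          have "g t \<in> {g x..g y}"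
            using t strict_mono_on_leD[OF m(2) in01(1) t01] strict_mono_on_leD[OF m(2) t01 in01(2)]
            by auto
          then have "f (g t) = c * g t + d" by (rule cd)
          then show ?thesis using ceq[OF t01] ab[OF t] by (simp add: algebra_simps)
        qed
        then show ?thesis by blast
      qed
      moreover have "finite ?D" using B(1) C(1) finite_vimage_IntI[OF B(1) injg] by blast
      ultimately show ?thesis unfolding piecewise_linear_def by (intro exI[of _ ?D]) blast
    qed
    ultimately show ?thesis unfolding PL\<^sub>o_def by (auto simp: compose_def)
  qed
  have one: "(\<lambda>x\<in>{0..1}. x) \<in> carrier PL\<^sub>o"
  proof -
    have "homeomorphism {0..1} {0..1} (\<lambda>x\<in>{0..1::real}. x) (\<lambda>x. x)"
      using homeomorphism_cong[OF homeomorphism_ident, of "{0..1::real}" "{0..1}" "{0..1}"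
          "\<lambda>x\<in>{0..1::real}. x" "\<lambda>x. x"] by simp
    moreover have "piecewise_linear (\<lambda>x\<in>{0..1::real}. x)"
      unfolding piecewise_linear_def
      by (intro exI[of _ "{}"] conjI allI impI exI[of _ 1] exI[of _ 0]) auto
    ultimately show ?thesis by (auto simp: PL\<^sub>o_def strict_mono_on_def)
  qed
  show ?thesis
  proof (rule subgroupI)
    show "carrier PL\<^sub>o \<subseteq> carrier (BijGroup {0..1})" using Bij by (auto simp: BijGroup_def)
    show "carrier PL\<^sub>o \<noteq> {}" using one by blast
    show "inv\<^bsub>BijGroup {0..1}\<^esub> f \<in> carrier PL\<^sub>o" if "f \<in> carrier PL\<^sub>o" for f
      using inv[OF that] inv_BijGroup[OF Bij[OF that]] by (simp add: restrict_def)
    show "f \<otimes>\<^bsub>BijGroup {0..1}\<^esub> g \<in> carrier PL\<^sub>o" if "f \<in> carrier PL\<^sub>o" "g \<in> carrier PL\<^sub>o" for f g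
      using mult[OF that] Bij that by (simp add: BijGroup_def)
  qed
qed

lemma group_PL\<^sub>o: "group PL\<^sub>o"
  using group.subgroup_imp_group[OF group_BijGroup subgroup_PL\<^sub>o] by (simp add: PL\<^sub>o_def)

definition irreducible_PL :: "(real \<Rightarrow> real) set \<Rightarrow> bool" where
  "irreducible_PL G \<longleftrightarrow> \<not> (\<exists>x\<in>{0<..<1}. \<forall>g\<in>G. g x = x)"

definition chi_l :: "(real \<Rightarrow> real) \<Rightarrow> real" where
  "chi_l g = ln (vector_derivative g (at_right 0))"

definition chi_r :: "(real \<Rightarrow> real) \<Rightarrow> real" where
  "chi_r g = ln (vector_derivative g (at_left 1))"

definition real_group :: "real monoid" where
  "real_group = \<lparr>carrier = UNIV, monoid.mult = (+), one = 0\<rparr>"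

definition independent_characters :: "(real \<Rightarrow> real) set \<Rightarrow> bool" where
  "independent_characters G \<longleftrightarrow>
     G = kernel (PL\<^sub>o\<lparr>carrier := G\<rparr>) real_group chi_l <#>\<^bsub>PL\<^sub>o\<^esub>
         kernel (PL\<^sub>o\<lparr>carrier := G\<rparr>) real_group chi_r"

interpretation int_module: module "\<lambda>(n::int) (x::real). of_int n * x"
  by unfold_locales (auto simp: algebra_simps)

text \<open>Rank of an additive subgroup of the reals: the maximal number of elements that are
  linearly independent over the integers.\<close>
definition ab_rank :: "real set \<Rightarrow> enat" where
  "ab_rank A = (SUP B \<in> {B. B \<subseteq> A \<and> finite B \<and> int_module.independent B}. enat (card B))"

end

theory Submission
  imports Defs
begin

text \<open>
  For an irrational \<open>\<theta> > 0\<close> let \<open>G\<close> be generated by a map \<open>a\<close> that is the identity on \<open>[3/4, 1]\<close>,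
  pushes the points of \<open>]0, 3/4[\<close> to the left and has slope \<open>exp (-1)\<close> at \<open>0\<close>, and by two maps that are
  the identity on \<open>[0, 1/4]\<close>, push the points of \<open>]1/4, 1[\<close> to the right and have slopes \<open>exp (-1)\<close> and
  \<open>exp (-\<theta>)\<close> at \<open>1\<close>. The images of the two characters are then \<open>\<int>\<close> and \<open>\<int> + \<int>\<theta>\<close>, and every pair of
  values occurs, so the characters are independent and have ranks 1 and 2.

  The point is that isomorphisms respect the characters. The signs of \<open>\<chi>\<^sub>l\<close> and \<open>\<chi>\<^sub>r\<close> can be read off
  from the multiplication alone, by asking which elements \<open>t\<close> are able to move supports away: \<open>t\<close> is called
  evasive if for every finite set \<open>F\<close> of commutators and every commutator \<open>b\<close> there is a conjugate \<open>b'\<close> of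
  \<open>b\<close> such that \<open>F\<close> commutes with all conjugates of \<open>b'\<close> by powers \<open>t\<^sup>n\<close>, \<open>n \<ge> 0\<close>. Commutators are the
  identity near \<open>0\<close> and near \<open>1\<close>. If \<open>\<chi>\<^sub>l t \<le> 0\<close>, then \<open>t\<close> maps a small interval \<open>]0, \<epsilon>[\<close> to itself
  and irreducibility permits to conjugate the support of \<open>b\<close> into it, so \<open>t\<close> is evasive
  (\<open>evasive_if_chi_l\<close>); the case \<open>\<chi>\<^sub>r t \<le> 0\<close> is its mirror image. If both values are positive, then \<open>t\<close>
  pushes points away from both end points. By compactness there is a finite \<open>F\<close> that moves all points of
  \<open>[\<epsilon>, 1-\<epsilon>]\<close>; but the infimum of the support of an element that commutes with \<open>F\<close> is fixed by \<open>F\<close>,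
  and \<open>t\<close> eventually carries this infimum into \<open>[\<epsilon>, 1-\<epsilon>]\<close> (\<open>not_evasive\<close>).

  Consequently every isomorphism preserves the open quadrant \<open>\<chi>\<^sub>l > 0, \<chi>\<^sub>r > 0\<close>. A pair of characters is
  determined by this quadrant up to positive scaling and exchange (\<open>same_positive_cone\<close>). An exchange
  is excluded because \<open>\<theta>\<close> is irrational, and the scaling factor of \<open>\<chi>\<^sub>l\<close> is 1 because the image is \<open>\<int>\<close>
  on both sides (\<open>iso_preserves_characters\<close>). An isomorphism between the groups of \<open>\<theta>\<close> and \<open>\<eta>\<close> thus
  makes \<open>\<int> + \<int>\<eta>\<close> a multiple of \<open>\<int> + \<int>\<theta>\<close>, which leaves only countably many \<open>\<eta>\<close> for given \<open>\<theta>\<close>. The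
  isomorphism classes of these groups hence have the cardinality of the continuum, and one
  representative of each class makes up the collection.
\<close>

section \<open>The group of piecewise linear homeomorphisms and its germs\<close>

interpretation PL: group "PL\<^sub>o"
  by (rule group_PL\<^sub>o)

lemma PL_mult:
  assumes "f \<in> carrier PL\<^sub>o" "g \<in> carrier PL\<^sub>o" "x \<in> {0..1}"
  shows "(f \<otimes>\<^bsub>PL\<^sub>o\<^esub> g) x = f (g x)"
proof -
  have "f \<in> Bij {0..1}" "g \<in> Bij {0..1}"
    using subgroup.subset[OF subgroup_PL\<^sub>o] assms(1,2) by (auto simp: BijGroup_def)
  then show ?thesis
    using assms(3) by (simp add: PL\<^sub>o_def BijGroup_def compose_eq)
qed

lemma PL_one: "x \<in> {0..1} \<Longrightarrow> \<one>\<^bsub>PL\<^sub>o\<^esub> x = x"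
  by (simp add: PL\<^sub>o_def BijGroup_def)

lemma PL_strict_mono: "f \<in> carrier PL\<^sub>o \<Longrightarrow> strict_mono_on {0..1} f"
  by (simp add: PL\<^sub>o_def)

lemma PL_less_iff:
  assumes "f \<in> carrier PL\<^sub>o" "x \<in> {0..1}" "y \<in> {0..1}"
  shows "f x < f y \<longleftrightarrow> x < y"
  using strict_mono_on_less[OF PL_strict_mono] assms by blast

lemma PL_eq_iff:
  assumes "f \<in> carrier PL\<^sub>o" "x \<in> {0..1}" "y \<in> {0..1}"
  shows "f x = f y \<longleftrightarrow> x = y"
  using PL_less_iff[OF assms] PL_less_iff[OF assms(1,3,2)] by (cases x y rule: linorder_cases) auto

lemma PL_image: "f \<in> carrier PL\<^sub>o \<Longrightarrow> f ` {0..1} = {0..1}"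
  by (auto simp: PL\<^sub>o_def homeomorphism_def)

lemma PL_in: "f \<in> carrier PL\<^sub>o \<Longrightarrow> x \<in> {0..1} \<Longrightarrow> f x \<in> {0..1}"
  using PL_image by blast

lemma PL_continuous: "f \<in> carrier PL\<^sub>o \<Longrightarrow> continuous_on {0..1} f"
  by (auto simp: PL\<^sub>o_def homeomorphism_def)

lemma PL_eqI:
  assumes "f \<in> carrier PL\<^sub>o" "g \<in> carrier PL\<^sub>o" "\<And>x. x \<in> {0..1} \<Longrightarrow> f x = g x"
  shows "f = g"
  by (rule extensionalityI[of f "{0..1}"]) (use assms in \<open>auto simp: PL\<^sub>o_def\<close>)

lemma PL_endpoints:
  assumes "f \<in> carrier PL\<^sub>o"
  shows "f 0 = 0" "f 1 = 1"
proof -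
  obtain x y where xy: "x \<in> {0..1}" "f x = 0" "y \<in> {0..1}" "f y = 1"
    using PL_image[OF assms] by (metis (full_types) atLeastAtMost_iff imageE order_refl zero_le_one)
  have "\<not> f x < f 0" "\<not> f 1 < f y"
    using xy PL_less_iff[OF assms, of x 0] PL_less_iff[OF assms, of 1 y] by auto
  then show "f 0 = 0" "f 1 = 1"
    using xy PL_in[OF assms, of 0] PL_in[OF assms, of 1] by auto
qed

lemma PL_open_in:
  assumes "f \<in> carrier PL\<^sub>o" "x \<in> {0<..<1}"
  shows "f x \<in> {0<..<1}"
  using PL_less_iff[OF assms(1), of 0 x] PL_less_iff[OF assms(1), of x 1] PL_endpoints[OF assms(1)] assms(2)
  by auto

lemma PL_inv:
  assumes "f \<in> carrier PL\<^sub>o" "x \<in> {0..1}"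
  shows "(inv\<^bsub>PL\<^sub>o\<^esub> f) (f x) = x" "f ((inv\<^bsub>PL\<^sub>o\<^esub> f) x) = x"
  using PL_mult[OF PL.inv_closed[OF assms(1)] assms(1,2)] PL_mult[OF assms(1) PL.inv_closed[OF assms(1)] assms(2)]
    PL_one[OF assms(2)] assms(1) by simp_all

text \<open>Up to the first positive break point the graph is a segment through the origin.\<close>
lemma PL_germ_0:
  assumes "f \<in> carrier PL\<^sub>o"
  shows "\<exists>l>0. \<exists>d>0. d \<le> 1 \<and> (\<forall>x\<in>{0..d}. f x = l * x)"
proof -
  obtain B where B: "finite B" "\<And>x y. \<lbrakk>0 \<le> x; x < y; y \<le> 1; {x<..<y} \<inter> B = {}\<rbrakk>
      \<Longrightarrow> \<exists>a b. \<forall>t\<in>{x..y}. f t = a * t + b"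
    using assms unfolding PL\<^sub>o_def piecewise_linear_def by auto
  define d where "d = Min (insert 1 {x\<in>B. 0 < x})"
  have d: "0 < d" "d \<le> 1" "{0<..<d} \<inter> B = {}"
    using B(1) by (auto simp: d_def)
  obtain a b where ab: "\<And>t. t \<in> {0..d} \<Longrightarrow> f t = a * t + b"
    using B(2)[of 0 d] d by auto
  have b: "b = 0"
    using ab[of 0] d PL_endpoints[OF assms] by simp
  have "f 0 < f d"
    using PL_less_iff[OF assms, of 0 d] d by simp
  then have "a > 0"
    using ab[of d] d PL_endpoints[OF assms] b by (simp add: zero_less_mult_iff)
  then show ?thesis
    using ab b d by (intro exI[of _ a] conjI exI[of _ d]) auto
qed

lemma PL_germ_1:
  assumes "f \<in> carrier PL\<^sub>o"
  shows "\<exists>m>0. \<exists>d>0. d \<le> 1 \<and> (\<forall>x\<in>{1-d..1}. f x = 1 - m * (1 - x))"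
proof -
  obtain B where B: "finite B" "\<And>x y. \<lbrakk>0 \<le> x; x < y; y \<le> 1; {x<..<y} \<inter> B = {}\<rbrakk>
      \<Longrightarrow> \<exists>a b. \<forall>t\<in>{x..y}. f t = a * t + b"
    using assms unfolding PL\<^sub>o_def piecewise_linear_def by auto
  define e where "e = Max (insert 0 {x\<in>B. x < 1})"
  have e: "0 \<le> e" "e < 1" "{e<..<1} \<inter> B = {}"
    using B(1) by (auto simp: e_def not_less)
  obtain a b where ab: "\<And>t. t \<in> {e..1} \<Longrightarrow> f t = a * t + b"
    using B(2)[of e 1] e by auto
  have b: "b = 1 - a"
    using ab[of 1] e PL_endpoints[OF assms] by simp
  have "f e < f 1"
    using PL_less_iff[OF assms, of e 1] e by simp
  then have "a * (1 - e) > 0"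
    using ab[of e] e PL_endpoints[OF assms] b by (simp add: algebra_simps)
  then have "a > 0"
    using e by (simp add: zero_less_mult_iff)
  moreover have "\<forall>x\<in>{1-(1-e)..1}. f x = 1 - a * (1 - x)"
    using ab b by (simp add: algebra_simps)
  ultimately show ?thesis
    using e by (intro exI[of _ a] conjI exI[of _ "1 - e"]) auto
qed

lemma chi_l_eq:
  assumes "d > 0" "l > 0" "\<And>x. x \<in> {0..d} \<Longrightarrow> f x = l * x"
  shows "chi_l f = ln l"
proof -
  have "((\<lambda>x. l * x) has_vector_derivative l) (at 0 within {0..})"
    by (auto intro!: derivative_eq_intros)
  then have "(f has_vector_derivative l) (at 0 within {0..})"
    unfolding has_vector_derivative_def
    by (rule has_derivative_transform_within[OF _ assms(1)]) (use assms in \<open>auto simp: dist_real_def\<close>)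
  then have "(f has_vector_derivative l) (at 0 within {0<..})"
    by (rule has_vector_derivative_within_subset) auto
  then show ?thesis
    unfolding chi_l_def by (simp add: vector_derivative_within)
qed

lemma chi_r_eq:
  assumes "d > 0" "m > 0" "\<And>x. x \<in> {1-d..1} \<Longrightarrow> f x = 1 - m * (1 - x)"
  shows "chi_r f = ln m"
proof -
  have "((\<lambda>x. 1 - m * (1 - x)) has_vector_derivative m) (at 1 within {..1})"
    by (auto intro!: derivative_eq_intros)
  then have "(f has_vector_derivative m) (at 1 within {..1})"
    unfolding has_vector_derivative_def
    by (rule has_derivative_transform_within[OF _ assms(1)]) (use assms in \<open>auto simp: dist_real_def\<close>)
  then have "(f has_vector_derivative m) (at 1 within {..<1})"
    by (rule has_vector_derivative_within_subset) auto
  then show ?thesis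
    unfolding chi_r_def by (simp add: vector_derivative_within)
qed

lemma chi_l_germ:
  assumes "f \<in> carrier PL\<^sub>o"
  obtains d where "d > 0" "d \<le> 1" "\<And>x. x \<in> {0..d} \<Longrightarrow> f x = exp (chi_l f) * x"
  using PL_germ_0[OF assms] chi_l_eq[of _ _ f] by (metis exp_ln)

lemma chi_r_germ:
  assumes "f \<in> carrier PL\<^sub>o"
  obtains d where "d > 0" "d \<le> 1" "\<And>x. x \<in> {1-d..1} \<Longrightarrow> f x = 1 - exp (chi_r f) * (1 - x)"
  using PL_germ_1[OF assms] chi_r_eq[of _ _ f] by (metis exp_ln)

lemma chi_l_mult:
  assumes "f \<in> carrier PL\<^sub>o" "g \<in> carrier PL\<^sub>o"
  shows "chi_l (f \<otimes>\<^bsub>PL\<^sub>o\<^esub> g) = chi_l f + chi_l g"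
proof -
  obtain d where d: "d > 0" "d \<le> 1" "\<And>x. x \<in> {0..d} \<Longrightarrow> f x = exp (chi_l f) * x"
    by (rule chi_l_germ[OF assms(1)]) blast
  obtain e where e: "e > 0" "e \<le> 1" "\<And>x. x \<in> {0..e} \<Longrightarrow> g x = exp (chi_l g) * x"
    by (rule chi_l_germ[OF assms(2)]) blast
  define r where "r = min e (d / exp (chi_l g))"
  have "(f \<otimes>\<^bsub>PL\<^sub>o\<^esub> g) x = exp (chi_l f + chi_l g) * x" if "x \<in> {0..r}" for x
  proof -
    have "g x = exp (chi_l g) * x" "x \<in> {0..1}" "exp (chi_l g) * x \<in> {0..d}"
      using that e by (auto simp: r_def field_simps)
    then show ?thesis
      using PL_mult[OF assms] d(3) by (simp add: exp_add)
  qed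
  then have "chi_l (f \<otimes>\<^bsub>PL\<^sub>o\<^esub> g) = ln (exp (chi_l f + chi_l g))"
    by (intro chi_l_eq[of r]) (use d e in \<open>auto simp: r_def\<close>)
  then show ?thesis by simp
qed

lemma chi_r_mult:
  assumes "f \<in> carrier PL\<^sub>o" "g \<in> carrier PL\<^sub>o"
  shows "chi_r (f \<otimes>\<^bsub>PL\<^sub>o\<^esub> g) = chi_r f + chi_r g"
proof -
  obtain d where d: "d > 0" "d \<le> 1" "\<And>x. x \<in> {1-d..1} \<Longrightarrow> f x = 1 - exp (chi_r f) * (1 - x)"
    by (rule chi_r_germ[OF assms(1)]) blast
  obtain e where e: "e > 0" "e \<le> 1" "\<And>x. x \<in> {1-e..1} \<Longrightarrow> g x = 1 - exp (chi_r g) * (1 - x)"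
    by (rule chi_r_germ[OF assms(2)]) blast
  define r where "r = min e (d / exp (chi_r g))"
  have "(f \<otimes>\<^bsub>PL\<^sub>o\<^esub> g) x = 1 - exp (chi_r f + chi_r g) * (1 - x)" if "x \<in> {1-r..1}" for x
  proof -
    have "1 - x \<le> d / exp (chi_r g)" "1 - x \<le> e"
      using that by (auto simp: r_def)
    then have "g x = 1 - exp (chi_r g) * (1 - x)" "x \<in> {0..1}" "exp (chi_r g) * (1 - x) \<in> {0..d}"
      using that e by (auto simp: field_simps)
    then show ?thesis
      using PL_mult[OF assms] d(3)[of "1 - exp (chi_r g) * (1 - x)"] by (simp add: exp_add)
  qed
  then have "chi_r (f \<otimes>\<^bsub>PL\<^sub>o\<^esub> g) = ln (exp (chi_r f + chi_r g))"
    by (intro chi_r_eq[of r]) (use d e in \<open>auto simp: r_def\<close>)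
  then show ?thesis by simp
qed

lemma PL_near_0:
  assumes "f \<in> carrier PL\<^sub>o"
  shows "eventually (\<lambda>x. f x = exp (chi_l f) * x) (at_right 0)"
proof -
  obtain d where "d > 0" "\<And>x. x \<in> {0..d} \<Longrightarrow> f x = exp (chi_l f) * x"
    by (rule chi_l_germ[OF assms]) blast
  then show ?thesis
    unfolding eventually_at_right_field by (intro exI[of _ d]) auto
qed

lemma PL_near_1:
  assumes "f \<in> carrier PL\<^sub>o"
  shows "eventually (\<lambda>x. f x = 1 - exp (chi_r f) * (1 - x)) (at_left 1)"
proof -
  obtain d where "d > 0" "\<And>x. x \<in> {1-d..1} \<Longrightarrow> f x = 1 - exp (chi_r f) * (1 - x)"
    by (rule chi_r_germ[OF assms]) blast
  then show ?thesis
    unfolding eventually_at_left_field by (intro exI[of _ "1 - d"]) auto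
qed

lemma PL_pow_Suc:
  assumes "f \<in> carrier PL\<^sub>o" "x \<in> {0..1}"
  shows "(f [^]\<^bsub>PL\<^sub>o\<^esub> Suc n) x = f ((f [^]\<^bsub>PL\<^sub>o\<^esub> n) x)"
  using PL_mult[OF assms(1) PL.nat_pow_closed[OF assms(1)] assms(2)] PL.nat_pow_Suc2[OF assms(1)] by simp

lemma PL_pow_0: "x \<in> {0..1} \<Longrightarrow> (f [^]\<^bsub>PL\<^sub>o\<^esub> (0::nat)) x = x"
  using PL_one by simp

section \<open>Supports and orbits\<close>

definition moved :: "(real \<Rightarrow> real) \<Rightarrow> real set" where
  "moved f = {x\<in>{0..1}. f x \<noteq> x}"

lemma PL_commute_if_disjoint:
  assumes "f \<in> carrier PL\<^sub>o" "h \<in> carrier PL\<^sub>o" "moved f \<inter> moved h = {}"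
  shows "f \<otimes>\<^bsub>PL\<^sub>o\<^esub> h = h \<otimes>\<^bsub>PL\<^sub>o\<^esub> f"
proof (rule PL_eqI)
  fix x :: real assume x: "x \<in> {0..1}"
  have disj: "f y = y \<or> h y = y" if "y \<in> {0..1}" for y
    using assms(3) that by (auto simp: moved_def)
  have "f (h x) = h (f x)"
  proof (cases "h x = x")
    case True
    then show ?thesis
      using disj[OF PL_in[OF assms(1) x]] PL_eq_iff[OF assms(1) PL_in[OF assms(1) x] x] by auto
  next
    case False
    then show ?thesis
      using disj[OF PL_in[OF assms(2) x]] PL_eq_iff[OF assms(2) PL_in[OF assms(2) x] x] disj[OF x] by auto
  qed
  then show "(f \<otimes>\<^bsub>PL\<^sub>o\<^esub> h) x = (h \<otimes>\<^bsub>PL\<^sub>o\<^esub> f) x"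
    using PL_mult[OF assms(1,2) x] PL_mult[OF assms(2,1) x] by simp
qed (use assms in auto)

text \<open>The equation says that \<open>h\<close> is the conjugate of \<open>b\<close> by \<open>k\<close>. Conjugation is written without inverses
  throughout, since equations of this form are easily transported along isomorphisms.\<close>
lemma moved_conj:
  assumes "k \<in> carrier PL\<^sub>o" "h \<in> carrier PL\<^sub>o" "b \<in> carrier PL\<^sub>o"
    and eq: "h \<otimes>\<^bsub>PL\<^sub>o\<^esub> k = k \<otimes>\<^bsub>PL\<^sub>o\<^esub> b"
  shows "moved h = k ` moved b"
proof -
  have *: "h (k x) = k x \<longleftrightarrow> b x = x" if x: "x \<in> {0..1}" for x
  proof -
    have "h (k x) = k (b x)"
      using PL_mult[OF assms(2,1) x] PL_mult[OF assms(1,3) x] eq by simp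
    then show ?thesis
      using PL_eq_iff[OF assms(1) PL_in[OF assms(3) x] x] by simp
  qed
  show ?thesis
  proof (rule equalityI; rule subsetI)
    fix y assume y: "y \<in> moved h"
    then have "y \<in> k ` {0..1}"
      using PL_image[OF assms(1)] by (simp add: moved_def)
    then show "y \<in> k ` moved b"
      using y * by (auto simp: moved_def)
  next
    fix y assume "y \<in> k ` moved b"
    then show "y \<in> moved h"
      using * PL_in[OF assms(1)] by (auto simp: moved_def)
  qed
qed

text \<open>With \<open>b = h\<close> this says that the infimum of the support of \<open>h\<close> is fixed by everything that
  commutes with \<open>h\<close>.\<close>
lemma Inf_moved_conj:
  assumes "k \<in> carrier PL\<^sub>o" "h \<in> carrier PL\<^sub>o" "b \<in> carrier PL\<^sub>o"
    and eq: "h \<otimes>\<^bsub>PL\<^sub>o\<^esub> k = k \<otimes>\<^bsub>PL\<^sub>o\<^esub> b" and ne: "moved b \<noteq> {}"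
  shows "Inf (moved h) = k (Inf (moved b))"
proof (rule cInf_eq_non_empty)
  have bdd: "bdd_below (moved b)"
    by (rule bdd_belowI[of _ 0]) (auto simp: moved_def)
  have s: "Inf (moved b) \<in> {0..1}"
  proof -
    obtain v where v: "v \<in> moved b" using ne by blast
    have "0 \<le> Inf (moved b)"
      using ne by (intro cInf_greatest) (auto simp: moved_def)
    moreover have "Inf (moved b) \<le> v"
      using v bdd by (rule cInf_lower)
    ultimately show ?thesis using v by (auto simp: moved_def)
  qed
  have le: "k x \<le> k y \<longleftrightarrow> x \<le> y" if "x \<in> {0..1}" "y \<in> {0..1}" for x y
    using PL_less_iff[OF assms(1) that(2,1)] by (simp add: not_less[symmetric])
  show "moved h \<noteq> {}"
    using ne moved_conj[OF assms(1-4)] by simp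
  show "k (Inf (moved b)) \<le> y" if "y \<in> moved h" for y
    using that cInf_lower[OF _ bdd] le[OF s] unfolding moved_conj[OF assms(1-4)] by (auto simp: moved_def)
  show "y \<le> k (Inf (moved b))" if y: "\<And>x. x \<in> moved h \<Longrightarrow> y \<le> x" for y
  proof (cases "y < 0")
    case True
    then show ?thesis using PL_in[OF assms(1) s] by simp
  next
    case False
    obtain v where "v \<in> moved b" using ne by blast
    then have "y \<le> k v" "k v \<in> {0..1}"
      using y[of "k v"] PL_in[OF assms(1), of v] unfolding moved_conj[OF assms(1-4)]
      by (auto simp: moved_def)
    then have "y \<in> k ` {0..1}"
      using False PL_image[OF assms(1)] by simp
    then obtain w where w: "w \<in> {0..1}" "y = k w" by blast
    have "w \<le> x" if "x \<in> moved b" for x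
      using y[of "k x"] that w le[of w x] unfolding moved_conj[OF assms(1-4)]
      by (auto simp: moved_def)
    then have "w \<le> Inf (moved b)"
      using ne by (intro cInf_greatest)
    then show ?thesis using w le s by simp
  qed
qed

text \<open>Otherwise the infimum of the orbit would be a fixed point in the open interval.\<close>
lemma irreducible_orbit_near_0:
  assumes K: "subgroup K PL\<^sub>o" and irr: "irreducible_PL K" and u: "u \<in> {0<..<1}" and e: "e > 0"
  shows "\<exists>g\<in>K. g u < e"
proof (rule ccontr)
  assume no: "\<not> ?thesis"
  have PL: "g \<in> carrier PL\<^sub>o" if "g \<in> K" for g
    using subgroup.mem_carrier[OF K] that .
  have open_u: "g u \<in> {0<..<1}" if "g \<in> K" for g
    using PL_open_in[OF PL[OF that] u] .
  define m where "m = (INF g\<in>K. g u)"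
  have one: "\<one>\<^bsub>PL\<^sub>o\<^esub> \<in> K"
    using subgroup.one_closed[OF K] .
  have bdd: "bdd_below ((\<lambda>g. g u) ` K)"
    using open_u by (intro bdd_belowI[of _ 0]) force
  have m_le: "m \<le> g u" if "g \<in> K" for g
    unfolding m_def using bdd that by (rule cINF_lower)
  have "e \<le> m"
    unfolding m_def using no one by (intro cINF_greatest) (auto simp: not_less)
  then have m: "m \<in> {0<..<1}"
    using e m_le[OF one] PL_one[of u] u by auto
  have down: "\<not> m < h m" if h: "h \<in> K" for h
  proof
    assume "m < h m"
    then obtain g where g: "g \<in> K" "g u < h m"
      using cINF_less_iff[OF _ bdd, of "h m"] one by (auto simp: m_def)
    let ?i = "inv\<^bsub>PL\<^sub>o\<^esub> h"
    have i: "?i \<in> K"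
      using subgroup.m_inv_closed[OF K h] .
    have "?i (g u) < ?i (h m)"
      using PL_less_iff[OF PL[OF i], of "g u" "h m"] g open_u[OF g(1)] PL_open_in[OF PL[OF h] m] by simp
    also have "\<dots> = m"
      using PL_inv(1)[OF PL[OF h]] m by simp
    also have "m \<le> (?i \<otimes>\<^bsub>PL\<^sub>o\<^esub> g) u"
      using m_le subgroup.m_closed[OF K i g(1)] by blast
    also have "\<dots> = ?i (g u)"
      using PL_mult[OF PL[OF i] PL[OF g(1)]] u by simp
    finally show False by simp
  qed
  obtain h where h: "h \<in> K" "h m \<noteq> m"
    using irr m unfolding irreducible_PL_def by blast
  have i: "inv\<^bsub>PL\<^sub>o\<^esub> h \<in> K"
    using subgroup.m_inv_closed[OF K h(1)] .
  have "h m < m"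
    using down[OF h(1)] h(2) by simp
  then have "(inv\<^bsub>PL\<^sub>o\<^esub> h) (h m) < (inv\<^bsub>PL\<^sub>o\<^esub> h) m"
    using PL_less_iff[OF PL[OF i], of "h m" m] m PL_open_in[OF PL[OF h(1)] m] by simp
  then show False
    using down[OF i] PL_inv(1)[OF PL[OF h(1)], of m] m by simp
qed

lemma irreducible_orbit_near_1:
  assumes K: "subgroup K PL\<^sub>o" and irr: "irreducible_PL K" and u: "u \<in> {0<..<1}" and e: "e < 1"
  shows "\<exists>g\<in>K. e < g u"
proof (rule ccontr)
  assume no: "\<not> ?thesis"
  have PL: "g \<in> carrier PL\<^sub>o" if "g \<in> K" for g
    using subgroup.mem_carrier[OF K] that .
  have open_u: "g u \<in> {0<..<1}" if "g \<in> K" for g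
    using PL_open_in[OF PL[OF that] u] .
  define m where "m = (SUP g\<in>K. g u)"
  have one: "\<one>\<^bsub>PL\<^sub>o\<^esub> \<in> K"
    using subgroup.one_closed[OF K] .
  have bdd: "bdd_above ((\<lambda>g. g u) ` K)"
    using open_u by (intro bdd_aboveI[of _ 1]) force
  have m_ge: "g u \<le> m" if "g \<in> K" for g
    unfolding m_def using that bdd by (rule cSUP_upper)
  have "m \<le> e"
    unfolding m_def using no one by (intro cSUP_least) (auto simp: not_less)
  then have m: "m \<in> {0<..<1}"
    using e m_ge[OF one] PL_one[of u] u by auto
  have up: "\<not> h m < m" if h: "h \<in> K" for h
  proof
    assume "h m < m"
    then obtain g where g: "g \<in> K" "h m < g u"
      using less_cSUP_iff[OF _ bdd, of "h m"] one by (auto simp: m_def)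
    let ?i = "inv\<^bsub>PL\<^sub>o\<^esub> h"
    have i: "?i \<in> K"
      using subgroup.m_inv_closed[OF K h] .
    have "m = ?i (h m)"
      using PL_inv(1)[OF PL[OF h]] m by simp
    also have "?i (h m) < ?i (g u)"
      using PL_less_iff[OF PL[OF i], of "h m" "g u"] g open_u[OF g(1)] PL_open_in[OF PL[OF h] m] by simp
    also have "\<dots> = (?i \<otimes>\<^bsub>PL\<^sub>o\<^esub> g) u"
      using PL_mult[OF PL[OF i] PL[OF g(1)]] u by simp
    also have "\<dots> \<le> m"
      using m_ge subgroup.m_closed[OF K i g(1)] by blast
    finally show False by simp
  qed
  obtain h where h: "h \<in> K" "h m \<noteq> m"
    using irr m unfolding irreducible_PL_def by blast
  have i: "inv\<^bsub>PL\<^sub>o\<^esub> h \<in> K"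
    using subgroup.m_inv_closed[OF K h(1)] .
  have "m < h m"
    using up[OF h(1)] h(2) by simp
  then have "(inv\<^bsub>PL\<^sub>o\<^esub> h) m < (inv\<^bsub>PL\<^sub>o\<^esub> h) (h m)"
    using PL_less_iff[OF PL[OF i], of m "h m"] m PL_open_in[OF PL[OF h(1)] m] by simp
  then show False
    using up[OF i] PL_inv(1)[OF PL[OF h(1)], of m] m by simp
qed

section \<open>An algebraic description of the signs of the two characters\<close>

definition commutators :: "('a, 'b) monoid_scheme \<Rightarrow> 'a set" where
  "commutators G = {c \<in> carrier G. \<exists>x\<in>carrier G. \<exists>y\<in>carrier G.
     c \<otimes>\<^bsub>G\<^esub> (y \<otimes>\<^bsub>G\<^esub> x) = x \<otimes>\<^bsub>G\<^esub> y}"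

text \<open>Here \<open>h\<close> is the conjugate of \<open>b\<close> by \<open>t\<^sup>n g\<close>. Commutators stand in for the elements that are the
  identity near both end points, because that property is not expressed in terms of the multiplication.\<close>
definition evasive :: "('a, 'b) monoid_scheme \<Rightarrow> 'a \<Rightarrow> bool" where
  "evasive G t \<longleftrightarrow> (\<forall>F b. finite F \<and> F \<subseteq> commutators G \<and> b \<in> commutators G \<longrightarrow>
     (\<exists>g\<in>carrier G. \<forall>n::nat. \<forall>f\<in>F. \<forall>h\<in>carrier G.
        h \<otimes>\<^bsub>G\<^esub> (t [^]\<^bsub>G\<^esub> n \<otimes>\<^bsub>G\<^esub> g) = (t [^]\<^bsub>G\<^esub> n \<otimes>\<^bsub>G\<^esub> g) \<otimes>\<^bsub>G\<^esub> b \<longrightarrow>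
        f \<otimes>\<^bsub>G\<^esub> h = h \<otimes>\<^bsub>G\<^esub> f))"

lemma commutators_iso:
  assumes "group G" "group H" "\<phi> \<in> iso G H" "c \<in> carrier G"
  shows "\<phi> c \<in> commutators H \<longleftrightarrow> c \<in> commutators G"
proof -
  interpret G: group G by fact
  have mult: "\<phi> (x \<otimes>\<^bsub>G\<^esub> y) = \<phi> x \<otimes>\<^bsub>H\<^esub> \<phi> y" if "x \<in> carrier G" "y \<in> carrier G" for x y
    using assms(3) that by (auto simp: iso_def hom_def)
  have im: "\<phi> ` carrier G = carrier H" and inj: "inj_on \<phi> (carrier G)"
    using assms(3) by (auto simp: iso_def bij_betw_def)
  have *: "\<phi> c \<otimes>\<^bsub>H\<^esub> (\<phi> y \<otimes>\<^bsub>H\<^esub> \<phi> x) = \<phi> x \<otimes>\<^bsub>H\<^esub> \<phi> y \<longleftrightarrow> c \<otimes>\<^bsub>G\<^esub> (y \<otimes>\<^bsub>G\<^esub> x) = x \<otimes>\<^bsub>G\<^esub> y"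
    if "x \<in> carrier G" "y \<in> carrier G" for x y
    using that assms(4) inj_on_eq_iff[OF inj, of "c \<otimes>\<^bsub>G\<^esub> (y \<otimes>\<^bsub>G\<^esub> x)" "x \<otimes>\<^bsub>G\<^esub> y"]
    by (simp add: mult)
  show ?thesis
    using assms(4) * by (auto simp: commutators_def im[symmetric])
qed

lemma evasive_iso:
  assumes "group G" "group H" "\<phi> \<in> iso G H" "t \<in> carrier G" "evasive G t"
  shows "evasive H (\<phi> t)"
  unfolding evasive_def
proof (intro allI impI, elim conjE)
  fix F b assume F: "finite F" "F \<subseteq> commutators H" and b: "b \<in> commutators H"
  interpret G: group G by fact
  interpret H: group H by fact
  interpret group_hom G H \<phi>
    using assms(3) by unfold_locales (auto simp: iso_def)
  have im: "\<phi> ` carrier G = carrier H" and inj: "inj_on \<phi> (carrier G)"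
    using assms(3) by (auto simp: iso_def bij_betw_def)
  have sub: "commutators H \<subseteq> \<phi> ` carrier G"
    unfolding im by (auto simp: commutators_def)
  obtain F' where F': "F' \<subseteq> carrier G" "finite F'" "F = \<phi> ` F'"
    using finite_subset_image[OF F(1), of \<phi> "carrier G"] F(2) sub by (metis order_trans)
  obtain b' where b': "b' \<in> carrier G" "b = \<phi> b'"
    using b sub by blast
  have "F' \<subseteq> commutators G" "b' \<in> commutators G"
    using commutators_iso[OF assms(1-3)] F' F(2) b b' by auto
  then obtain g where g: "g \<in> carrier G"
    "\<And>n f h. \<lbrakk>f \<in> F'; h \<in> carrier G;
        h \<otimes>\<^bsub>G\<^esub> (t [^]\<^bsub>G\<^esub> (n::nat) \<otimes>\<^bsub>G\<^esub> g) = (t [^]\<^bsub>G\<^esub> n \<otimes>\<^bsub>G\<^esub> g) \<otimes>\<^bsub>G\<^esub> b'\<rbrakk> \<Longrightarrow> f \<otimes>\<^bsub>G\<^esub> h = h \<otimes>\<^bsub>G\<^esub> f"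
    using assms(5) F'(2) unfolding evasive_def by metis
  show "\<exists>g\<in>carrier H. \<forall>n::nat. \<forall>f\<in>F. \<forall>h\<in>carrier H.
      h \<otimes>\<^bsub>H\<^esub> (\<phi> t [^]\<^bsub>H\<^esub> n \<otimes>\<^bsub>H\<^esub> g) = (\<phi> t [^]\<^bsub>H\<^esub> n \<otimes>\<^bsub>H\<^esub> g) \<otimes>\<^bsub>H\<^esub> b \<longrightarrow> f \<otimes>\<^bsub>H\<^esub> h = h \<otimes>\<^bsub>H\<^esub> f"
  proof (intro bexI[of _ "\<phi> g"] allI ballI impI)
    fix n :: nat and f h
    assume f: "f \<in> F" and h: "h \<in> carrier H"
      and eq: "h \<otimes>\<^bsub>H\<^esub> (\<phi> t [^]\<^bsub>H\<^esub> n \<otimes>\<^bsub>H\<^esub> \<phi> g) = (\<phi> t [^]\<^bsub>H\<^esub> n \<otimes>\<^bsub>H\<^esub> \<phi> g) \<otimes>\<^bsub>H\<^esub> b"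
    obtain f' where f': "f' \<in> F'" "f = \<phi> f'" using f F'(3) by blast
    obtain h' where h': "h' \<in> carrier G" "h = \<phi> h'" using h im by blast
    let ?k = "t [^]\<^bsub>G\<^esub> n \<otimes>\<^bsub>G\<^esub> g"
    have "\<phi> (h' \<otimes>\<^bsub>G\<^esub> ?k) = \<phi> (?k \<otimes>\<^bsub>G\<^esub> b')"
      using eq h' g(1) b' assms(4) by (simp add: hom_nat_pow)
    then have "h' \<otimes>\<^bsub>G\<^esub> ?k = ?k \<otimes>\<^bsub>G\<^esub> b'"
      by (rule inj_onD[OF inj]) (use h'(1) g(1) b'(1) assms(4) in simp_all)
    then have "f' \<otimes>\<^bsub>G\<^esub> h' = h' \<otimes>\<^bsub>G\<^esub> f'"
      using g(2) f'(1) h'(1) by blast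
    then have "\<phi> (f' \<otimes>\<^bsub>G\<^esub> h') = \<phi> (h' \<otimes>\<^bsub>G\<^esub> f')"
      by simp
    then show "f \<otimes>\<^bsub>H\<^esub> h = h \<otimes>\<^bsub>H\<^esub> f"
      using f' h' F'(1) by (simp add: subset_iff)
  qed (use g(1) in simp)
qed

context
  fixes K
  assumes K: "subgroup K PL\<^sub>o"
begin

lemma in_PL: "f \<in> K \<Longrightarrow> f \<in> carrier PL\<^sub>o"
  using subgroup.mem_carrier[OF K] .

lemma pow_in: "t \<in> K \<Longrightarrow> t [^]\<^bsub>PL\<^sub>o\<^esub> (n::nat) \<in> K"
  by (induction n) (simp_all add: subgroup.one_closed[OF K] subgroup.m_closed[OF K])

lemma commutators_in: "c \<in> commutators (PL\<^sub>o\<lparr>carrier := K\<rparr>) \<Longrightarrow> c \<in> K"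
  by (simp add: commutators_def)

lemma chi_commutator:
  assumes "c \<in> commutators (PL\<^sub>o\<lparr>carrier := K\<rparr>)"
  shows "chi_l c = 0" "chi_r c = 0"
proof -
  obtain x y where c: "c \<in> carrier PL\<^sub>o" "x \<in> carrier PL\<^sub>o" "y \<in> carrier PL\<^sub>o"
    "c \<otimes>\<^bsub>PL\<^sub>o\<^esub> (y \<otimes>\<^bsub>PL\<^sub>o\<^esub> x) = x \<otimes>\<^bsub>PL\<^sub>o\<^esub> y"
    using assms in_PL by (auto simp: commutators_def)
  have "chi_l c + (chi_l y + chi_l x) = chi_l x + chi_l y"
    "chi_r c + (chi_r y + chi_r x) = chi_r x + chi_r y"
    using c(1-3) arg_cong[OF c(4), of chi_l] arg_cong[OF c(4), of chi_r]
    by (simp_all add: chi_l_mult chi_r_mult)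
  then show "chi_l c = 0" "chi_r c = 0" by simp_all
qed

text \<open>Once the support of \<open>b\<close> has been moved into the set \<open>U\<close>, the map \<open>t\<close> keeps it there, where \<open>f\<close> is
  the identity; supports are then disjoint.\<close>
lemma commute_if_moved_into_trap:
  assumes f: "f \<in> K" and h: "h \<in> K" and t: "t \<in> K" and g: "g \<in> K" and b: "b \<in> K"
    and U: "U \<subseteq> {0..1}" "\<And>x. x \<in> U \<Longrightarrow> f x = x" "\<And>x. x \<in> U \<Longrightarrow> t x \<in> U"
      "\<And>x. x \<in> moved b \<Longrightarrow> g x \<in> U"
    and eq: "h \<otimes>\<^bsub>PL\<^sub>o\<^esub> (t [^]\<^bsub>PL\<^sub>o\<^esub> (n::nat) \<otimes>\<^bsub>PL\<^sub>o\<^esub> g) = (t [^]\<^bsub>PL\<^sub>o\<^esub> n \<otimes>\<^bsub>PL\<^sub>o\<^esub> g) \<otimes>\<^bsub>PL\<^sub>o\<^esub> b"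
  shows "f \<otimes>\<^bsub>PL\<^sub>o\<^esub> h = h \<otimes>\<^bsub>PL\<^sub>o\<^esub> f"
proof (rule PL_commute_if_disjoint)
  have pow_U: "(t [^]\<^bsub>PL\<^sub>o\<^esub> n) x \<in> U" if "x \<in> U" for x and n :: nat
  proof (induction n)
    case 0
    then show ?case using that PL_pow_0 U(1) by (metis subsetD)
  next
    case (Suc n)
    then show ?case using PL_pow_Suc[OF in_PL[OF t], of x n] that U(1,3) by auto
  qed
  have "moved h = (t [^]\<^bsub>PL\<^sub>o\<^esub> n \<otimes>\<^bsub>PL\<^sub>o\<^esub> g) ` moved b"
    using moved_conj[OF _ in_PL[OF h] in_PL[OF b] eq] in_PL[OF t] in_PL[OF g] by simp
  also have "\<dots> = (t [^]\<^bsub>PL\<^sub>o\<^esub> n) ` g ` moved b"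
    unfolding image_image using PL_mult[OF PL.nat_pow_closed[OF in_PL[OF t]] in_PL[OF g]]
    by (intro image_cong) (auto simp: moved_def)
  also have "\<dots> \<subseteq> U"
    using U(4) pow_U by blast
  finally show "moved f \<inter> moved h = {}"
    using U(2) by (auto simp: moved_def)
qed (use in_PL f h in auto)

lemma evasiveI:
  assumes t: "t \<in> K"
    and trap: "\<And>F b. \<lbrakk>finite F; F \<subseteq> commutators (PL\<^sub>o\<lparr>carrier := K\<rparr>); b \<in> commutators (PL\<^sub>o\<lparr>carrier := K\<rparr>)\<rbrakk> \<Longrightarrow>
      \<exists>U\<subseteq>{0..1}. (\<forall>f\<in>F. \<forall>x\<in>U. f x = x) \<and> (\<forall>x\<in>U. t x \<in> U) \<and> (\<exists>g\<in>K. \<forall>x\<in>moved b. g x \<in> U)"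
  shows "evasive (PL\<^sub>o\<lparr>carrier := K\<rparr>) t"
  unfolding evasive_def
proof (intro allI impI, elim conjE)
  fix F b assume F: "finite F" "F \<subseteq> commutators (PL\<^sub>o\<lparr>carrier := K\<rparr>)" and b: "b \<in> commutators (PL\<^sub>o\<lparr>carrier := K\<rparr>)"
  obtain U where U: "U \<subseteq> {0..1}" "\<forall>f\<in>F. \<forall>x\<in>U. f x = x" "\<forall>x\<in>U. t x \<in> U"
    "\<exists>g\<in>K. \<forall>x\<in>moved b. g x \<in> U"
    using trap[OF F b] by (elim exE conjE)
  obtain g where g: "g \<in> K" "\<forall>x\<in>moved b. g x \<in> U"
    using U(4) by (elim bexE)
  have "f \<otimes>\<^bsub>PL\<^sub>o\<^esub> h = h \<otimes>\<^bsub>PL\<^sub>o\<^esub> f"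
    if f: "f \<in> F" and h: "h \<in> K"
      and eq: "h \<otimes>\<^bsub>PL\<^sub>o\<^esub> (t [^]\<^bsub>PL\<^sub>o\<^esub> (n::nat) \<otimes>\<^bsub>PL\<^sub>o\<^esub> g) = (t [^]\<^bsub>PL\<^sub>o\<^esub> n \<otimes>\<^bsub>PL\<^sub>o\<^esub> g) \<otimes>\<^bsub>PL\<^sub>o\<^esub> b" for f h n
  proof (rule commute_if_moved_into_trap[OF _ h t g(1) commutators_in[OF b] U(1) _ _ _ eq])
    show "f \<in> K" using f F(2) commutators_in by blast
  qed (use U(2,3) g(2) f in auto)
  then show "\<exists>g\<in>carrier (PL\<^sub>o\<lparr>carrier := K\<rparr>). \<forall>n::nat. \<forall>f\<in>F. \<forall>h\<in>carrier (PL\<^sub>o\<lparr>carrier := K\<rparr>).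
      h \<otimes>\<^bsub>PL\<^sub>o\<lparr>carrier := K\<rparr>\<^esub> (t [^]\<^bsub>PL\<^sub>o\<lparr>carrier := K\<rparr>\<^esub> n \<otimes>\<^bsub>PL\<^sub>o\<lparr>carrier := K\<rparr>\<^esub> g)
        = (t [^]\<^bsub>PL\<^sub>o\<lparr>carrier := K\<rparr>\<^esub> n \<otimes>\<^bsub>PL\<^sub>o\<lparr>carrier := K\<rparr>\<^esub> g) \<otimes>\<^bsub>PL\<^sub>o\<lparr>carrier := K\<rparr>\<^esub> b \<longrightarrow>
      f \<otimes>\<^bsub>PL\<^sub>o\<lparr>carrier := K\<rparr>\<^esub> h = h \<otimes>\<^bsub>PL\<^sub>o\<lparr>carrier := K\<rparr>\<^esub> f"
    using g(1) by (auto simp: PL.nat_pow_consistent[symmetric])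
qed

text \<open>A small interval at \<open>0\<close> serves as the trap: all of \<open>F\<close> is the identity on it, \<open>t\<close> maps it to
  itself because its slope at \<open>0\<close> is at most 1, and a suitable element moves the support of \<open>b\<close> into it.\<close>
lemma evasive_if_chi_l:
  assumes irr: "irreducible_PL K" and t: "t \<in> K" "chi_l t \<le> 0"
  shows "evasive (PL\<^sub>o\<lparr>carrier := K\<rparr>) t"
proof (rule evasiveI[OF t(1)])
  fix F b assume F: "finite F" "F \<subseteq> commutators (PL\<^sub>o\<lparr>carrier := K\<rparr>)" and b: "b \<in> commutators (PL\<^sub>o\<lparr>carrier := K\<rparr>)"
  have "eventually (\<lambda>x. f x = x) (at_right 0)" if "f \<in> F" for f
    using PL_near_0[of f] chi_commutator(1)[of f] that F(2) in_PL commutators_in by (auto simp: subset_iff)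
  then have "eventually (\<lambda>x. \<forall>f\<in>F. f x = x) (at_right 0)"
    using F(1) by (simp add: eventually_ball_finite)
  then obtain e1 where e1: "e1 > 0" "\<And>f x. f \<in> F \<Longrightarrow> 0 < x \<Longrightarrow> x < e1 \<Longrightarrow> f x = x"
    unfolding eventually_at_right_field by auto
  obtain e2 where e2: "e2 > 0" "\<And>x. 0 < x \<Longrightarrow> x < e2 \<Longrightarrow> t x = exp (chi_l t) * x"
    using PL_near_0[OF in_PL[OF t(1)]] unfolding eventually_at_right_field by auto
  define e where "e = min 1 (min e1 e2)"
  have t_le: "t x \<le> x" if "0 < x" "x < e" for x
    using e2(2)[of x] that t(2) by (simp add: e_def)
  obtain u0 where u0: "u0 < 1" "\<And>x. u0 < x \<Longrightarrow> x < 1 \<Longrightarrow> b x = x"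
    using PL_near_1[of b] chi_commutator(2)[OF b] in_PL[OF commutators_in[OF b]]
    unfolding eventually_at_left_field by auto
  define u where "u = max u0 (1/2)"
  have u: "u \<in> {0<..<1}" using u0 by (auto simp: u_def)
  have b_PL: "b \<in> carrier PL\<^sub>o" using in_PL[OF commutators_in[OF b]] .
  have moved_b: "0 < x \<and> x \<le> u \<and> x \<le> 1" if "x \<in> moved b" for x
    using that u0(2)[of x] PL_endpoints[OF b_PL] by (cases "x = 0 \<or> x = 1") (force simp: moved_def u_def)+
  obtain g where g: "g \<in> K" "g u < e"
    using irreducible_orbit_near_0[OF K irr u, of e] e1(1) e2(1) by (auto simp: e_def)
  have "t x \<in> {0<..<e}" if "x \<in> {0<..<e}" for x
    using PL_open_in[OF in_PL[OF t(1)], of x] t_le[of x] that by (auto simp: e_def)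
  moreover have "g x \<in> {0<..<e}" if "x \<in> moved b" for x
    using moved_b[OF that] PL_less_iff[OF in_PL[OF g(1)], of u x] PL_open_in[OF in_PL[OF g(1)], of x] g(2) u
    by (auto simp: not_less)
  ultimately show "\<exists>U\<subseteq>{0..1}. (\<forall>f\<in>F. \<forall>x\<in>U. f x = x) \<and> (\<forall>x\<in>U. t x \<in> U) \<and> (\<exists>g\<in>K. \<forall>x\<in>moved b. g x \<in> U)"
    using e1(2) g(1) by (intro exI[of _ "{0<..<e}"]) (auto simp: e_def)
qed

lemma evasive_if_chi_r:
  assumes irr: "irreducible_PL K" and t: "t \<in> K" "chi_r t \<le> 0"
  shows "evasive (PL\<^sub>o\<lparr>carrier := K\<rparr>) t"
proof (rule evasiveI[OF t(1)])
  fix F b assume F: "finite F" "F \<subseteq> commutators (PL\<^sub>o\<lparr>carrier := K\<rparr>)" and b: "b \<in> commutators (PL\<^sub>o\<lparr>carrier := K\<rparr>)"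
  have "eventually (\<lambda>x. f x = x) (at_left 1)" if "f \<in> F" for f
    using PL_near_1[of f] chi_commutator(2)[of f] that F(2) in_PL commutators_in by (auto simp: subset_iff)
  then have "eventually (\<lambda>x. \<forall>f\<in>F. f x = x) (at_left 1)"
    using F(1) by (simp add: eventually_ball_finite)
  then obtain e1 where e1: "e1 < 1" "\<And>f x. f \<in> F \<Longrightarrow> e1 < x \<Longrightarrow> x < 1 \<Longrightarrow> f x = x"
    unfolding eventually_at_left_field by auto
  obtain e2 where e2: "e2 < 1" "\<And>x. e2 < x \<Longrightarrow> x < 1 \<Longrightarrow> t x = 1 - exp (chi_r t) * (1 - x)"
    using PL_near_1[OF in_PL[OF t(1)]] unfolding eventually_at_left_field by auto
  define e where "e = max 0 (max e1 e2)"
  have t_ge: "x \<le> t x" if "e < x" "x < 1" for x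
  proof -
    have "exp (chi_r t) * (1 - x) \<le> 1 - x"
      using that t(2) by (intro mult_left_le_one_le) auto
    moreover have "t x = 1 - exp (chi_r t) * (1 - x)"
      using e2(2)[of x] that by (simp add: e_def)
    ultimately show ?thesis by linarith
  qed
  obtain u0 where u0: "0 < u0" "\<And>x. 0 < x \<Longrightarrow> x < u0 \<Longrightarrow> b x = x"
    using PL_near_0[of b] chi_commutator(1)[OF b] in_PL[OF commutators_in[OF b]]
    unfolding eventually_at_right_field by auto
  define u where "u = min u0 (1/2)"
  have u: "u \<in> {0<..<1}" using u0 by (auto simp: u_def)
  have b_PL: "b \<in> carrier PL\<^sub>o" using in_PL[OF commutators_in[OF b]] .
  have moved_b: "x < 1 \<and> u \<le> x \<and> 0 \<le> x" if "x \<in> moved b" for x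
    using that u0(2)[of x] PL_endpoints[OF b_PL] by (cases "x = 0 \<or> x = 1") (force simp: moved_def u_def)+
  obtain g where g: "g \<in> K" "e < g u"
    using irreducible_orbit_near_1[OF K irr u, of e] e1(1) e2(1) by (auto simp: e_def)
  have "t x \<in> {e<..<1}" if "x \<in> {e<..<1}" for x
    using PL_open_in[OF in_PL[OF t(1)], of x] t_ge[of x] that by (auto simp: e_def)
  moreover have "g x \<in> {e<..<1}" if "x \<in> moved b" for x
    using moved_b[OF that] PL_less_iff[OF in_PL[OF g(1)], of x u] PL_open_in[OF in_PL[OF g(1)], of x] g(2) u
    by (auto simp: not_less)
  ultimately show "\<exists>U\<subseteq>{0..1}. (\<forall>f\<in>F. \<forall>x\<in>U. f x = x) \<and> (\<forall>x\<in>U. t x \<in> U) \<and> (\<exists>g\<in>K. \<forall>x\<in>moved b. g x \<in> U)"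
    using e1(2) g(1) by (intro exI[of _ "{e<..<1}"]) (auto simp: e_def)
qed

text \<open>Compactness of the interval: the sets of points that are moved by the single elements are open.\<close>
lemma finite_moving_set:
  assumes C: "C \<subseteq> carrier PL\<^sub>o" "\<And>x. x \<in> {0<..<1} \<Longrightarrow> \<exists>c\<in>C. c x \<noteq> x" and e: "e > 0"
  shows "\<exists>F. finite F \<and> F \<subseteq> C \<and> (\<forall>x\<in>{e..1-e}. \<exists>f\<in>F. f x \<noteq> x)"
proof -
  define M where "M c = {0<..<1} \<inter> (\<lambda>x. c x - x) -` (-{0})" for c :: "real \<Rightarrow> real"
  have M: "open (M c)" if "c \<in> C" for c
  proof -
    have "continuous_on {0<..<1} (\<lambda>x. c x - x)"
      by (intro continuous_intros continuous_on_subset[OF PL_continuous[of c]]) (use C(1) that in auto)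
    then show ?thesis
      unfolding M_def by (rule continuous_open_preimage) auto
  qed
  have "{e..1-e} \<subseteq> (\<Union>c\<in>C. M c)"
    using C(2) e by (fastforce simp: M_def)
  then obtain F where "F \<subseteq> C" "finite F" "{e..1-e} \<subseteq> (\<Union>c\<in>F. M c)"
    using compactE_image[OF compact_Icc, of C M e "1-e"] M by blast
  then show ?thesis
    by (intro exI[of _ F]) (fastforce simp: M_def)
qed

text \<open>Choose \<open>F\<close> to move every point of \<open>[\<epsilon>, 1-\<epsilon>]\<close>. If \<open>t\<close> were evasive, all iterates under \<open>t\<close> of the
  infimum of the support of some conjugate of \<open>b\<close> would be fixed by \<open>F\<close> and so avoid \<open>[\<epsilon>, 1-\<epsilon>]\<close>. But
  near the end points \<open>t\<close> expands linearly away from them, so the iterates leave the neighbourhood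
  that they started in, and \<open>\<epsilon>\<close> is so small that they cannot jump over \<open>[\<epsilon>, 1-\<epsilon>]\<close>.\<close>
lemma not_evasive:
  assumes C: "\<And>x. x \<in> {0<..<1} \<Longrightarrow> \<exists>c\<in>commutators (PL\<^sub>o\<lparr>carrier := K\<rparr>). c x \<noteq> x"
    and t: "t \<in> K" "chi_l t > 0" "chi_r t > 0"
  shows "\<not> evasive (PL\<^sub>o\<lparr>carrier := K\<rparr>) t"
proof
  let ?C = "commutators (PL\<^sub>o\<lparr>carrier := K\<rparr>)"
  assume evasive: "evasive (PL\<^sub>o\<lparr>carrier := K\<rparr>) t"
  have C_PL: "?C \<subseteq> carrier PL\<^sub>o"
    using commutators_in in_PL by blast
  obtain d1 where d1: "d1 > 0" "\<And>x. x \<in> {0..d1} \<Longrightarrow> t x = exp (chi_l t) * x"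
    by (rule chi_l_germ[OF in_PL[OF t(1)]]) blast
  obtain d2 where d2: "d2 > 0" "\<And>x. x \<in> {1-d2..1} \<Longrightarrow> t x = 1 - exp (chi_r t) * (1 - x)"
    by (rule chi_r_germ[OF in_PL[OF t(1)]]) blast
  \<comment> \<open>The last two bounds keep \<open>t\<close> from mapping a point of \<open>]0, e[\<close> or \<open>]1-e, 1[\<close> across the middle.\<close>
  define e where "e = Min {d1, d2, 1/2, 1 / (2 * exp (chi_l t)), 1 / (2 * exp (chi_r t))}"
  have e: "0 < e" "e \<le> d1" "e \<le> d2" "e \<le> 1/2" "e \<le> 1 / (2 * exp (chi_l t))" "e \<le> 1 / (2 * exp (chi_r t))"
    using d1(1) d2(1) by (auto simp: e_def)
  obtain F where F: "finite F" "F \<subseteq> ?C" "\<And>x. x \<in> {e..1-e} \<Longrightarrow> \<exists>f\<in>F. f x \<noteq> x"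
    using finite_moving_set[OF C_PL C e(1)] by blast
  obtain b where b: "b \<in> ?C" "b (1/2) \<noteq> 1/2"
    using C[of "1/2"] by auto
  have b_PL: "b \<in> carrier PL\<^sub>o" using C_PL b(1) by blast
  have half: "1/2 \<in> moved b" using b(2) by (simp add: moved_def)
  obtain d where d: "d > 0" "\<And>x. x \<in> {0..d} \<Longrightarrow> b x = exp (chi_l b) * x"
    by (rule chi_l_germ[OF b_PL]) blast
  define s where "s = Inf (moved b)"
  have "d \<le> x" if "x \<in> moved b" for x
    using that d(2)[of x] chi_commutator(1)[OF b(1)] by (force simp: moved_def)
  then have "d \<le> s"
    unfolding s_def using half by (intro cInf_greatest) auto
  moreover have "s \<le> 1/2"
    unfolding s_def using half by (intro cInf_lower bdd_belowI[of _ 0]) (auto simp: moved_def)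
  ultimately have s: "s \<in> {0<..<1}" using d(1) by auto
  obtain g where g: "g \<in> K" "\<And>n f h. \<lbrakk>f \<in> F; h \<in> K;
      h \<otimes>\<^bsub>PL\<^sub>o\<^esub> (t [^]\<^bsub>PL\<^sub>o\<^esub> (n::nat) \<otimes>\<^bsub>PL\<^sub>o\<^esub> g) = (t [^]\<^bsub>PL\<^sub>o\<^esub> n \<otimes>\<^bsub>PL\<^sub>o\<^esub> g) \<otimes>\<^bsub>PL\<^sub>o\<^esub> b\<rbrakk> \<Longrightarrow> f \<otimes>\<^bsub>PL\<^sub>o\<^esub> h = h \<otimes>\<^bsub>PL\<^sub>o\<^esub> f"
    using evasive[unfolded evasive_def, rule_format, of F b] F(1,2) b(1)
    by (auto simp: PL.nat_pow_consistent[symmetric] simp del: PL.nat_pow_Suc) blast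
  define z where "z n = (t [^]\<^bsub>PL\<^sub>o\<^esub> (n::nat)) (g s)" for n
  have gs: "g s \<in> {0<..<1}"
    using PL_open_in[OF in_PL[OF g(1)] s] .
  have z_0: "z 0 = g s"
    unfolding z_def using PL_pow_0 gs by simp
  have z_Suc: "z (Suc n) = t (z n)" for n
    unfolding z_def using gs by (intro PL_pow_Suc[OF in_PL[OF t(1)]]) simp
  have z_in: "z n \<in> {0<..<1}" for n
    unfolding z_def by (rule PL_open_in[OF PL.nat_pow_closed[OF in_PL[OF t(1)]] gs])
  have fixed: "f (z n) = z n" if f: "f \<in> F" for f n
  proof -
    define k where "k = t [^]\<^bsub>PL\<^sub>o\<^esub> n \<otimes>\<^bsub>PL\<^sub>o\<^esub> g"
    define h where "h = k \<otimes>\<^bsub>PL\<^sub>o\<^esub> b \<otimes>\<^bsub>PL\<^sub>o\<^esub> inv\<^bsub>PL\<^sub>o\<^esub> k"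
    have fK: "f \<in> K" and bK: "b \<in> K"
      using commutators_in F(2) f b(1) by blast+
    have kK: "k \<in> K"
      unfolding k_def using subgroup.m_closed[OF K] pow_in[OF t(1)] g(1) by blast
    then have k: "k \<in> carrier PL\<^sub>o" "k \<in> K"
      using in_PL by blast+
    have h: "h \<in> K"
      unfolding h_def using k bK subgroup.m_closed[OF K] subgroup.m_inv_closed[OF K] by simp
    have conj: "h \<otimes>\<^bsub>PL\<^sub>o\<^esub> k = k \<otimes>\<^bsub>PL\<^sub>o\<^esub> b"
      unfolding h_def using k b_PL by (simp add: PL.m_assoc)
    have "Inf (moved h) = k s"
      unfolding s_def using Inf_moved_conj[OF k(1) in_PL[OF h] b_PL conj] half by blast
    moreover have "k s = z n"
      unfolding k_def z_def using PL_mult in_PL t(1) g(1) s by simp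
    moreover have "h \<otimes>\<^bsub>PL\<^sub>o\<^esub> f = f \<otimes>\<^bsub>PL\<^sub>o\<^esub> h"
      using g(2)[OF f h] conj unfolding k_def by simp
    moreover have "moved h \<noteq> {}"
      using moved_conj[OF k(1) in_PL[OF h] b_PL conj] half by blast
    ultimately show ?thesis
      using Inf_moved_conj[OF in_PL[OF fK] in_PL[OF h] in_PL[OF h]] by simp
  qed
  have out: "z n < e \<or> 1 - e < z n" for n
    using F(3)[of "z n"] fixed by force
  show False
  proof (cases "z 0 < e")
    case True
    have *: "z n = exp (chi_l t) ^ n * z 0 \<and> z n < e" for n
    proof (induction n)
      case (Suc n)
      have tz: "z (Suc n) = exp (chi_l t) * z n"
        using d1(2)[of "z n"] z_Suc z_in[of n] Suc e(2) by auto
      also have "\<dots> < exp (chi_l t) * e"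
        using Suc by simp
      also have "\<dots> \<le> 1/2"
        using e(5) by (simp add: field_simps)
      finally show ?case
        using out[of "Suc n"] e(4) tz Suc by auto
    qed (use True in simp)
    obtain n where "e / z 0 < exp (chi_l t) ^ n"
      using real_arch_pow[of "exp (chi_l t)"] t(2) by auto
    then show False
      using *[of n] z_in[of 0] by (simp add: field_simps)
  next
    case False
    have *: "1 - z n = exp (chi_r t) ^ n * (1 - z 0) \<and> 1 - z n < e" for n
    proof (induction n)
      case 0
      then show ?case using False out[of 0] by simp
    next
      case (Suc n)
      have tz: "1 - z (Suc n) = exp (chi_r t) * (1 - z n)"
        using d2(2)[of "z n"] z_Suc z_in[of n] Suc e(3) by auto
      also have "\<dots> < exp (chi_r t) * e"
        using Suc by simp
      also have "\<dots> \<le> 1/2"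
        using e(6) by (simp add: field_simps)
      finally show ?case
        using out[of "Suc n"] e(4) tz Suc by auto
    qed
    obtain n where "e / (1 - z 0) < exp (chi_r t) ^ n"
      using real_arch_pow[of "exp (chi_r t)"] t(3) by auto
    then show False
      using *[of n] z_in[of 0] by (simp add: field_simps)
  qed
qed

end

section \<open>Pairs of real characters with the same positive cone\<close>

lemma hom_real_mult:
  assumes "\<psi> \<in> hom G real_group" "x \<in> carrier G" "y \<in> carrier G"
  shows "\<psi> (x \<otimes>\<^bsub>G\<^esub> y) = \<psi> x + \<psi> y"
  using assms by (simp add: hom_def real_group_def)

lemma hom_real_one:
  assumes "group G" "\<psi> \<in> hom G real_group"
  shows "\<psi> \<one>\<^bsub>G\<^esub> = 0"
proof -
  interpret group G by fact
  show ?thesis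
    using hom_real_mult[OF assms(2) one_closed one_closed] by simp
qed

lemma hom_real_inv:
  assumes "group G" "\<psi> \<in> hom G real_group" "x \<in> carrier G"
  shows "\<psi> (inv\<^bsub>G\<^esub> x) = - \<psi> x"
proof -
  interpret group G by fact
  show ?thesis
    using hom_real_mult[OF assms(2) inv_closed[OF assms(3)] assms(3)] hom_real_one[OF assms(1,2)] assms(3)
    by simp
qed

lemma hom_real_int_pow:
  fixes G (structure)
  assumes "group G" "\<psi> \<in> hom G real_group" "x \<in> carrier G"
  shows "\<psi> (x [^]\<^bsub>G\<^esub> (n::int)) = of_int n * \<psi> x"
proof -
  interpret group G by fact
  have *: "\<psi> (x [^] (k::nat)) = real k * \<psi> x" for k
    using assms(3) by (induction k)
      (simp_all add: hom_real_one[OF assms(1,2)] hom_real_mult[OF assms(2)] algebra_simps)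
  show ?thesis
    using assms(3) by (cases n rule: int_cases2)
      (simp_all add: int_pow_int int_pow_neg * hom_real_inv[OF assms(1,2)])
qed

text \<open>The difference \<open>d\<close> of the two sides is a character that vanishes on \<open>a\<close> and \<open>b\<close>. If \<open>d t < 0\<close>,
  then a high power of \<open>t\<close>, corrected by powers of \<open>a\<close> and \<open>b\<close>, lies in the cone at a bounded distance
  from the origin, while \<open>y\<close> becomes negative on it. Hence \<open>d \<ge> 0\<close> everywhere, which for a character
  means \<open>d = 0\<close>.\<close>
lemma positive_on_cone_imp_combination:
  fixes G (structure)
  assumes G: "group G" and hom: "x1 \<in> hom G real_group" "x2 \<in> hom G real_group" "y \<in> hom G real_group"
    and a: "a \<in> carrier G" "x1 a > 0" "x2 a = 0" and b: "b \<in> carrier G" "x1 b = 0" "x2 b > 0"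
    and pos: "\<And>t. t \<in> carrier G \<Longrightarrow> x1 t > 0 \<Longrightarrow> x2 t > 0 \<Longrightarrow> y t > 0"
    and t: "t \<in> carrier G"
  shows "y t = y a / x1 a * x1 t + y b / x2 b * x2 t"
proof -
  interpret group G by fact
  define d where "d t = y t - (y a / x1 a * x1 t + y b / x2 b * x2 t)" for t
  have nonneg: "d t \<ge> 0" if t: "t \<in> carrier G" for t
  proof (rule ccontr)
    assume neg: "\<not> d t \<ge> 0"
    obtain N :: nat where "real N > (2 * \<bar>y a\<bar> + 2 * \<bar>y b\<bar>) / (- d t)"
      using reals_Archimedean2 by blast
    then have N: "real N * d t + 2 * \<bar>y a\<bar> + 2 * \<bar>y b\<bar> < 0"
      using neg by (simp add: field_simps)
    \<comment> \<open>These exponents bring \<open>x1 z\<close> into \<open>[x1 a, 2 * x1 a]\<close> and \<open>x2 z\<close> into \<open>[x2 b, 2 * x2 b]\<close>.\<close>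
    define i where "i = \<lceil>- (real N * x1 t) / x1 a\<rceil> + 1"
    define j where "j = \<lceil>- (real N * x2 t) / x2 b\<rceil> + 1"
    define z where "z = t [^] int N \<otimes> a [^] i \<otimes> b [^] j"
    have z: "\<psi> z = real N * \<psi> t + of_int i * \<psi> a + of_int j * \<psi> b" if "\<psi> \<in> hom G real_group" for \<psi>
      unfolding z_def using a b t by (simp add: hom_real_mult[OF that] hom_real_int_pow[OF G that] del: int_pow_int)
    define X where "X = real N * x1 t + of_int i * x1 a"
    define Y where "Y = real N * x2 t + of_int j * x2 b"
    have "- (real N * x1 t) / x1 a + 1 \<le> of_int i" "of_int i \<le> - (real N * x1 t) / x1 a + 2"
      "- (real N * x2 t) / x2 b + 1 \<le> of_int j" "of_int j \<le> - (real N * x2 t) / x2 b + 2"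
      unfolding i_def j_def by linarith+
    then have XY: "x1 a \<le> X" "X \<le> 2 * x1 a" "x2 b \<le> Y" "Y \<le> 2 * x2 b"
      using a(2) b(3) unfolding X_def Y_def by (simp_all add: field_simps)
    have "x1 z = X" "x2 z = Y"
      using z[OF hom(1)] z[OF hom(2)] a(3) b(2) by (simp_all add: X_def Y_def)
    then have "0 < y z"
      using pos[of z] XY a b t by (simp add: z_def)
    also have "y z = real N * d t + y a / x1 a * X + y b / x2 b * Y"
      using z[OF hom(3)] a(2) b(3) by (simp add: d_def X_def Y_def field_simps)
    also have "y a / x1 a * X \<le> \<bar>y a / x1 a\<bar> * (2 * x1 a)"
      using XY a(2) by (intro mult_mono abs_ge_self abs_ge_zero) auto
    also have "\<dots> = 2 * \<bar>y a\<bar>"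
      using a(2) by (simp add: abs_divide)
    also have "y b / x2 b * Y \<le> \<bar>y b / x2 b\<bar> * (2 * x2 b)"
      using XY b(3) by (intro mult_mono abs_ge_self abs_ge_zero) auto
    also have "\<dots> = 2 * \<bar>y b\<bar>"
      using b(3) by (simp add: abs_divide)
    finally show False using N by simp
  qed
  have "d (inv t) = - d t"
    unfolding d_def using t by (simp add: hom_real_inv[OF G] hom algebra_simps)
  then show ?thesis
    using nonneg[OF t] nonneg[of "inv t"] t unfolding d_def by simp
qed

text \<open>All products \<open>a\<^sup>N b\<close> lie in the cone.\<close>
lemma positive_on_cone_imp_nonneg_on_ray:
  fixes G (structure)
  assumes G: "group G" and hom: "x1 \<in> hom G real_group" "x2 \<in> hom G real_group" "y \<in> hom G real_group"
    and a: "a \<in> carrier G" "x1 a \<ge> 0" "x2 a \<ge> 0" and b: "b \<in> carrier G" "x1 b > 0" "x2 b > 0"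
    and pos: "\<And>t. t \<in> carrier G \<Longrightarrow> x1 t > 0 \<Longrightarrow> x2 t > 0 \<Longrightarrow> y t > 0"
  shows "y a \<ge> 0"
proof (rule ccontr)
  interpret group G by fact
  assume neg: "\<not> y a \<ge> 0"
  obtain N :: nat where "real N > y b / (- y a)"
    using reals_Archimedean2 by blast
  then have N: "real N * y a + y b < 0"
    using neg by (simp add: field_simps)
  have z: "\<psi> (a [^] int N \<otimes> b) = real N * \<psi> a + \<psi> b" if "\<psi> \<in> hom G real_group" for \<psi>
    using a b by (simp add: hom_real_mult[OF that] hom_real_int_pow[OF G that] del: int_pow_int)
  have "y (a [^] int N \<otimes> b) > 0"
    using z[OF hom(1)] z[OF hom(2)] a b
    by (intro pos) (simp_all add: add_nonneg_pos del: int_pow_int)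
  then show False using z[OF hom(3)] N by simp
qed

text \<open>Both \<open>y1\<close> and \<open>y2\<close> are combinations of \<open>x1\<close> and \<open>x2\<close> with nonnegative coefficients. As \<open>a\<close> and \<open>b\<close>
  lie on the two boundary rays of the cone, each of them is annihilated by one of \<open>y1\<close> and \<open>y2\<close>, so that
  the matrix of coefficients is diagonal or antidiagonal.\<close>
lemma same_positive_cone:
  fixes G (structure)
  assumes G: "group G" and hom: "x1 \<in> hom G real_group" "x2 \<in> hom G real_group"
      "y1 \<in> hom G real_group" "y2 \<in> hom G real_group"
    and a: "a \<in> carrier G" "x1 a > 0" "x2 a = 0" and b: "b \<in> carrier G" "x1 b = 0" "x2 b > 0"
    and cone: "\<And>t. t \<in> carrier G \<Longrightarrow> x1 t > 0 \<and> x2 t > 0 \<longleftrightarrow> y1 t > 0 \<and> y2 t > 0"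
  shows "(\<exists>r>0. \<exists>s>0. \<forall>t\<in>carrier G. y1 t = r * x1 t \<and> y2 t = s * x2 t) \<or>
         (\<exists>r>0. \<exists>s>0. \<forall>t\<in>carrier G. y1 t = r * x2 t \<and> y2 t = s * x1 t)"
proof -
  interpret group G by fact
  have ab: "a \<otimes> b \<in> carrier G" "x1 (a \<otimes> b) > 0" "x2 (a \<otimes> b) > 0"
    using a b by (simp_all add: hom_real_mult[OF hom(1)] hom_real_mult[OF hom(2)])
  have pos: "y1 t > 0" "y2 t > 0" if "t \<in> carrier G" "x1 t > 0" "x2 t > 0" for t
    using cone that by blast+
  have comb1: "y1 t = y1 a / x1 a * x1 t + y1 b / x2 b * x2 t" if "t \<in> carrier G" for t
    using positive_on_cone_imp_combination[OF G hom(1-3) a b pos(1) that] .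
  have comb2: "y2 t = y2 a / x1 a * x1 t + y2 b / x2 b * x2 t" if "t \<in> carrier G" for t
    using positive_on_cone_imp_combination[OF G hom(1,2,4) a b pos(2) that] .
  have nonneg: "y1 a \<ge> 0" "y1 b \<ge> 0" "y2 a \<ge> 0" "y2 b \<ge> 0"
    using positive_on_cone_imp_nonneg_on_ray[OF G hom(1,2) _ _ _ _ ab] hom(3,4) pos a b by simp_all
  have sum: "y1 a + y1 b > 0" "y2 a + y2 b > 0"
    using pos[OF ab] a b by (simp_all add: hom_real_mult[OF hom(3)] hom_real_mult[OF hom(4)])
  have "\<not> (y1 a > 0 \<and> y2 a > 0)" "\<not> (y1 b > 0 \<and> y2 b > 0)"
    using cone[OF a(1)] cone[OF b(1)] a b by simp_all
  then consider "y1 b = 0" "y2 a = 0" "y1 a > 0" "y2 b > 0" | "y1 a = 0" "y2 b = 0" "y1 b > 0" "y2 a > 0"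
    using nonneg sum by force
  then show ?thesis
  proof cases
    case 1
    then show ?thesis
      using comb1 comb2 a(2) b(3)
      by (intro disjI1 exI[of _ "y1 a / x1 a"] conjI exI[of _ "y2 b / x2 b"]) auto
  next
    case 2
    then show ?thesis
      using comb1 comb2 a(2) b(3)
      by (intro disjI2 exI[of _ "y1 b / x2 b"] conjI exI[of _ "y2 a / x1 a"]) auto
  qed
qed

section \<open>Ranks of groups of real numbers\<close>

text \<open>The rank is bounded by passing to the rational numbers: clearing denominators shows that independence
  over the integers persists, and in a vector space an independent set is no larger than a spanning set.\<close>
interpretation rat_space: vector_space "\<lambda>(q::rat) (x::real). of_rat q * x"
  by unfold_locales (auto simp: algebra_simps of_rat_add of_rat_mult)

lemma common_denominator:
  assumes "finite T"
  shows "\<exists>D::int. D \<noteq> 0 \<and> (\<forall>v\<in>T. \<exists>k::int. of_int D * (u v :: rat) = of_int k)"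
  using assms
proof (induction T)
  case empty
  then show ?case by (intro exI[of _ 1]) simp
next
  case (insert w T)
  then obtain D :: int where D: "D \<noteq> 0" "\<And>v. v \<in> T \<Longrightarrow> \<exists>k::int. of_int D * u v = of_int k"
    by blast
  obtain p q :: int where pq: "u w = Fract p q" "q > 0"
    using Rat_cases by metis
  have "\<exists>k::int. of_int (D * q) * u v = of_int k" if v: "v \<in> insert w T" for v
  proof (cases "v = w")
    case True
    have "of_int (D * q) * u v = of_int (D * p)"
      using pq True by (simp add: Fract_of_int_quotient)
    then show ?thesis by blast
  next
    case False
    then obtain k :: int where "of_int D * u v = of_int k"
      using v D(2) by blast
    then have "of_int (D * q) * u v = of_int (k * q)"
      by (simp add: algebra_simps)
    then show ?thesis by blast
  qed
  then show ?case
    using D(1) pq(2) by (intro exI[of _ "D * q"]) auto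
qed

lemma int_independent_imp_rat_independent:
  assumes "int_module.independent B"
  shows "rat_space.independent B"
proof
  assume "rat_space.dependent B"
  then obtain T u w where T: "finite T" "T \<subseteq> B" "(\<Sum>v\<in>T. of_rat (u v) * v) = 0" "w \<in> T" "u w \<noteq> 0"
    unfolding rat_space.dependent_explicit by blast
  obtain D :: int where D: "D \<noteq> 0" "\<forall>v\<in>T. \<exists>k::int. of_int D * u v = of_int k"
    using common_denominator[OF T(1)] by blast
  then obtain k :: "real \<Rightarrow> int" where k: "\<And>v. v \<in> T \<Longrightarrow> of_int D * u v = of_int (k v)"
    by metis
  have "(\<Sum>v\<in>T. of_int (k v) * v) = (\<Sum>v\<in>T. of_int D * (of_rat (u v) * v))"
  proof (intro sum.cong refl)
    fix v assume "v \<in> T"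
    then have "of_rat (of_int D * u v) = (of_rat (of_int (k v)) :: real)"
      using k by simp
    then show "of_int (k v) * v = of_int D * (of_rat (u v) * v)"
      by (simp add: of_rat_mult)
  qed
  also have "\<dots> = 0"
    using T(3) by (simp flip: sum_distrib_left)
  finally have "k w = 0"
    using int_module.independentD[OF assms T(1,2) _ T(4)] by blast
  then show False
    using k[OF T(4)] D(1) T(5) by simp
qed

lemma ab_rank_eqI:
  assumes "finite B" "B \<subseteq> A" "int_module.independent B" "A \<subseteq> rat_space.span B"
  shows "ab_rank A = enat (card B)"
  unfolding ab_rank_def
proof (rule antisym)
  show "(SUP C \<in> {C. C \<subseteq> A \<and> finite C \<and> int_module.independent C}. enat (card C)) \<le> enat (card B)"
  proof (rule SUP_least)
    fix C assume "C \<in> {C. C \<subseteq> A \<and> finite C \<and> int_module.independent C}"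
    then show "enat (card C) \<le> enat (card B)"
      using rat_space.independent_span_bound[OF assms(1), of C] int_independent_imp_rat_independent assms(4)
      by auto
  qed
  show "enat (card B) \<le> (SUP C \<in> {C. C \<subseteq> A \<and> finite C \<and> int_module.independent C}. enat (card C))"
    using assms by (intro SUP_upper) auto
qed

lemma int_combination_irrational_eq_0:
  fixes \<theta> :: real
  assumes "\<theta> \<notin> \<rat>" "of_int m + of_int n * \<theta> = 0"
  shows "m = 0 \<and> n = 0"
proof (cases "n = 0")
  case False
  then have "\<theta> = of_int (- m) / of_int n"
    using assms(2) by (simp add: field_simps)
  then show ?thesis
    using assms(1) by (metis Rats_divide Rats_of_int)
qed (use assms in simp)

lemma ab_rank_int_combinations:
  assumes "\<theta> \<notin> \<rat>"
  shows "ab_rank {of_int m + of_int n * \<theta> |m n. True} = 2"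
proof -
  let ?A = "{of_int m + of_int n * \<theta> |m n. True}"
  have "\<theta> \<noteq> 1" using assms by auto
  have "ab_rank ?A = enat (card {1, \<theta>})"
  proof (rule ab_rank_eqI)
    show "{1, \<theta>} \<subseteq> ?A"
      by (auto intro: exI[of _ 1] exI[of _ 0])
    show "int_module.independent {1, \<theta>}"
      unfolding int_module.dependent_finite[OF finite.insertI[OF finite.insertI[OF finite.emptyI]]]
      using int_combination_irrational_eq_0[OF assms] \<open>\<theta> \<noteq> 1\<close> by auto
    show "?A \<subseteq> rat_space.span {1, \<theta>}"
    proof
      fix x assume "x \<in> ?A"
      then obtain m n where x: "x = of_rat (of_int m) * 1 + of_rat (of_int n) * \<theta>" by auto
      show "x \<in> rat_space.span {1, \<theta>}"
        unfolding x by (intro rat_space.span_add rat_space.span_scale rat_space.span_base) auto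
    qed
  qed simp
  then show ?thesis
    using \<open>\<theta> \<noteq> 1\<close> by (simp add: numeral_eq_enat)
qed

lemma ab_rank_Ints: "ab_rank \<int> = 1"
proof -
  have "ab_rank \<int> = enat (card {1::real})"
  proof (rule ab_rank_eqI)
    show "int_module.independent {1}"
      unfolding int_module.dependent_finite[OF finite.insertI[OF finite.emptyI]] by auto
    show "\<int> \<subseteq> rat_space.span {1::real}"
    proof
      fix x :: real assume "x \<in> \<int>"
      then obtain m where x: "x = of_rat (of_int m) * 1" by (auto elim: Ints_cases)
      show "x \<in> rat_space.span {1}"
        unfolding x by (intro rat_space.span_scale rat_space.span_base) auto
    qed
  qed auto
  then show ?thesis by (simp add: one_enat_def)
qed

section \<open>Images of maps with countable fibres\<close>

text \<open>The domain embeds into \<open>f ` A \<times> \<nat>\<close> by numbering each fibre, and the image is infinite.\<close>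
lemma lepoll_image_countable_fibres:
  assumes "uncountable A" and fibre: "\<And>a. a \<in> A \<Longrightarrow> countable {x\<in>A. f x = f a}"
  shows "A \<lesssim> f ` A"
proof -
  have inf: "infinite (f ` A)"
  proof
    assume "finite (f ` A)"
    moreover have "countable {x\<in>A. f x = t}" if "t \<in> f ` A" for t
      using fibre that by auto
    ultimately have "countable (\<Union>t\<in>f ` A. {x\<in>A. f x = t})"
      by (intro countable_UN countable_finite[of "f ` A"])
    moreover have "A \<subseteq> (\<Union>t\<in>f ` A. {x\<in>A. f x = t})" by auto
    ultimately show False using assms(1) countable_subset by blast
  qed
  have "inj_on (\<lambda>a. (f a, to_nat_on {x\<in>A. f x = f a} a)) A"
  proof (rule inj_onI)
    fix a b assume ab: "a \<in> A" "b \<in> A"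
      "(f a, to_nat_on {x\<in>A. f x = f a} a) = (f b, to_nat_on {x\<in>A. f x = f b} b)"
    then show "a = b"
      using inj_on_to_nat_on[OF fibre[OF ab(1)]] by (auto simp: inj_on_def)
  qed
  then have "A \<lesssim> f ` A \<times> (UNIV :: nat set)"
    unfolding lepoll_def by (intro exI conjI) auto
  also have "f ` A \<times> (UNIV :: nat set) \<approx> f ` A"
    unfolding eqpoll_iff_card_of_ordIso
    using inf infinite_iff_card_of_nat by (intro card_of_Times_infinite_simps) auto
  finally show ?thesis .
qed

section \<open>Three generators\<close>

lemma PL_I:
  assumes f: "f \<in> extensional {0..1}" "f 0 = 0" "f 1 = 1" "continuous_on {0..1} f"
    "strict_mono_on {0..1} f" "piecewise_linear f"
  shows "f \<in> carrier PL\<^sub>o"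
proof -
  have inj: "inj_on f {0..1}"
    using f(5) strict_mono_on_imp_inj_on by blast
  have "f ` {0..1} = {0..1}"
  proof
    show "f ` {0..1} \<subseteq> {0..1}"
      using strict_mono_on_leD[OF f(5), of 0] strict_mono_on_leD[OF f(5), of _ 1] f(2,3) by fastforce
    show "{0..1} \<subseteq> f ` {0..1}"
      using IVT'[of f 0 _ 1] f(2-4) by fastforce
  qed
  then have "\<exists>g. homeomorphism {0..1} {0..1} f g"
    using homeomorphism_compact[OF compact_Icc f(4) _ inj] by blast
  then show ?thesis
    using f by (simp add: PL\<^sub>o_def)
qed

text \<open>Each map differs from the identity near one end point only, where it has slope \<open>l\<close>; a piece of
  slope 2 joins this germ to the identity. The two maps are mirror images under \<open>x \<mapsto> 1 - x\<close>. If
  \<open>0 < l < 1\<close>, then both inner pieces lie strictly on one side of the diagonal inside \<open>]0, 3/4[\<close> and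
  \<open>]1/4, 1[\<close>, respectively, so that these intervals are the supports.\<close>
definition fall :: "real \<Rightarrow> real \<Rightarrow> real" where
  "fall l = (\<lambda>x\<in>{0..1}. min x (max (2 * x - 3/4) (l * x)))"

definition ramp :: "real \<Rightarrow> real \<Rightarrow> real" where
  "ramp l = (\<lambda>x\<in>{0..1}. max x (min (2 * x - 1/4) (1 - l * (1 - x))))"

context
  fixes l :: real
  assumes l: "0 < l" "l < 1"
begin

lemma scale_less: "l * x < x" if "0 < x"
  using l that by simp

lemma fall_fixed: "x \<in> {3/4..1} \<Longrightarrow> fall l x = x"
  by (auto simp: fall_def)

lemma fall_near_0:
  assumes "x \<in> {0..3/8}"
  shows "fall l x = l * x"
proof -
  have "0 \<le> l * x" "l * x \<le> x"
    using assms l mult_left_le_one_le[of x l] by auto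
  then have "max (2 * x - 3/4) (l * x) = l * x"
    using assms by (intro max_absorb2) auto
  then show ?thesis
    using assms \<open>l * x \<le> x\<close> by (simp add: fall_def)
qed

lemma fall_less: "x \<in> {0<..<3/4} \<Longrightarrow> fall l x < x"
  using scale_less[of x] by (auto simp: fall_def)

lemma ramp_fixed: "x \<in> {0..1/4} \<Longrightarrow> ramp l x = x"
  by (auto simp: ramp_def)

lemma ramp_near_1:
  assumes "x \<in> {5/8..1}"
  shows "ramp l x = 1 - l * (1 - x)"
proof -
  have *: "0 \<le> l * (1 - x)" "l * (1 - x) \<le> 1 - x"
    using assms l mult_left_le_one_le[of "1 - x" l] by auto
  then have "min (2 * x - 1/4) (1 - l * (1 - x)) = 1 - l * (1 - x)"
    using assms by (intro min_absorb2) auto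
  then show ?thesis
    using assms * by (simp add: ramp_def)
qed

lemma ramp_greater:
  assumes "x \<in> {1/4<..<1}"
  shows "x < ramp l x"
proof -
  obtain z where z: "z = l * (1 - x)" "z < 1 - x"
    using scale_less[of "1 - x"] assms by auto
  show ?thesis
    using assms z(2) unfolding ramp_def z(1)[symmetric] by (auto simp: z(1)[symmetric])
qed

lemma fall_PL: "fall l \<in> carrier PL\<^sub>o"
proof (rule PL_I)
  show "continuous_on {0..1} (fall l)"
    unfolding fall_def restrict_def
    by (rule continuous_on_eq[of _ "\<lambda>x. min x (max (2 * x - 3/4) (l * x))"]) (auto intro!: continuous_intros)
  show "strict_mono_on {0..1} (fall l)"
  proof (rule strict_mono_onI)
    fix x y :: real assume xy: "x \<in> {0..1}" "y \<in> {0..1}" "x < y"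
    then have "l * x < l * y" using l by simp
    then show "fall l x < fall l y"
      using xy by (auto simp: fall_def min_def max_def)
  qed
  define c where "c = (3/4) / (2 - l)"
  have c: "2 * t - 3/4 \<le> l * t \<longleftrightarrow> t \<le> c" for t
    using l by (simp add: c_def field_simps)
  have c': "l * t \<le> 2 * t - 3/4 \<longleftrightarrow> c \<le> t" for t
    using l by (simp add: c_def field_simps)
  have pieces: "\<exists>a b. \<forall>t\<in>{x..y}. fall l t = a * t + b"
    if xy: "0 \<le> x" "x < y" "y \<le> 1" "{x<..<y} \<inter> {3/4, c} = {}" for x y
  proof -
    have cases: "y \<le> 3/4 \<or> 3/4 \<le> x" "y \<le> c \<or> c \<le> x"
      using xy by (auto simp: not_le)
    consider "3/4 \<le> x" | "y \<le> 3/4" "y \<le> c" | "y \<le> 3/4" "c \<le> x"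
      using cases by blast
    then show ?thesis
    proof cases
      case 1
      then have "fall l t = 1 * t + 0" if "t \<in> {x..y}" for t
        using fall_fixed that xy by simp
      then show ?thesis by blast
    next
      case 2
      have "fall l t = l * t + 0" if t: "t \<in> {x..y}" for t
      proof -
        have "l * t \<le> t" using t xy l mult_left_le_one_le[of t l] by simp
        moreover have "2 * t - 3/4 \<le> l * t" using c[of t] t 2 by simp
        ultimately show ?thesis using t xy by (auto simp: fall_def)
      qed
      then show ?thesis by blast
    next
      case 3
      have "fall l t = 2 * t + (- 3/4)" if t: "t \<in> {x..y}" for t
      proof -
        have "l * t \<le> 2 * t - 3/4" using c'[of t] t 3 by simp
        then show ?thesis using t xy 3 by (auto simp: fall_def)
      qed
      then show ?thesis by blast
    qed
  qed
  show "piecewise_linear (fall l)"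
    unfolding piecewise_linear_def by (intro exI[of _ "{3/4, c}"] conjI allI impI pieces) auto
qed (auto simp: fall_def)

lemma ramp_PL: "ramp l \<in> carrier PL\<^sub>o"
proof (rule PL_I)
  show "continuous_on {0..1} (ramp l)"
    unfolding ramp_def restrict_def
    by (rule continuous_on_eq[of _ "\<lambda>x. max x (min (2 * x - 1/4) (1 - l * (1 - x)))"]) (auto intro!: continuous_intros)
  show "strict_mono_on {0..1} (ramp l)"
  proof (rule strict_mono_onI)
    fix x y :: real assume xy: "x \<in> {0..1}" "y \<in> {0..1}" "x < y"
    then have "l * (1 - y) < l * (1 - x)" using l by simp
    then show "ramp l x < ramp l y"
      using xy by (auto simp: ramp_def min_def max_def)
  qed
  define c where "c = (5/4 - l) / (2 - l)"
  have c: "2 * t - 1/4 \<le> 1 - l * (1 - t) \<longleftrightarrow> t \<le> c" for t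
    using l by (simp add: c_def field_simps)
  have c': "1 - l * (1 - t) \<le> 2 * t - 1/4 \<longleftrightarrow> c \<le> t" for t
    using l by (simp add: c_def field_simps)
  have pieces: "\<exists>a b. \<forall>t\<in>{x..y}. ramp l t = a * t + b"
    if xy: "0 \<le> x" "x < y" "y \<le> 1" "{x<..<y} \<inter> {1/4, c} = {}" for x y
  proof -
    have cases: "y \<le> 1/4 \<or> 1/4 \<le> x" "y \<le> c \<or> c \<le> x"
      using xy by (auto simp: not_le)
    consider "y \<le> 1/4" | "1/4 \<le> x" "y \<le> c" | "1/4 \<le> x" "c \<le> x"
      using cases by blast
    then show ?thesis
    proof cases
      case 1
      then have "ramp l t = 1 * t + 0" if "t \<in> {x..y}" for t
        using ramp_fixed that xy by simp
      then show ?thesis by blast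
    next
      case 2
      have "ramp l t = 2 * t + (- 1/4)" if t: "t \<in> {x..y}" for t
      proof -
        have "2 * t - 1/4 \<le> 1 - l * (1 - t)" using c[of t] t 2 by simp
        then show ?thesis using t xy 2 by (auto simp: ramp_def)
      qed
      then show ?thesis by blast
    next
      case 3
      have "ramp l t = l * t + (1 - l)" if t: "t \<in> {x..y}" for t
      proof -
        have "l * (1 - t) \<le> 1 - t" using t xy l mult_left_le_one_le[of "1 - t" l] by simp
        moreover have "1 - l * (1 - t) \<le> 2 * t - 1/4" using c'[of t] t 3 by simp
        ultimately show ?thesis using t xy by (auto simp: ramp_def algebra_simps)
      qed
      then show ?thesis by blast
    qed
  qed
  show "piecewise_linear (ramp l)"
    unfolding piecewise_linear_def by (intro exI[of _ "{1/4, c}"] conjI allI impI pieces) auto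
qed (auto simp: ramp_def)

lemma chi_fall: "chi_l (fall l) = ln l" "chi_r (fall l) = 0"
  using chi_l_eq[of "3/8" l "fall l"] chi_r_eq[of "1/4" 1 "fall l"] fall_near_0 fall_fixed l by simp_all

lemma chi_ramp: "chi_l (ramp l) = 0" "chi_r (ramp l) = ln l"
  using chi_l_eq[of "1/4" 1 "ramp l"] chi_r_eq[of "3/8" l "ramp l"] ramp_near_1 ramp_fixed l by simp_all

end

text \<open>Commutators are permuted by conjugation, so it suffices to move \<open>h y = a q\<close>. The commutator of
  \<open>a\<close> and \<open>b\<close> maps \<open>b (a q) = a q\<close> to \<open>a (b q)\<close>, and \<open>b q \<noteq> q\<close>.\<close>
lemma commutator_moves:
  assumes K: "subgroup K PL\<^sub>o" and a: "a \<in> K" and b: "b \<in> K" and h: "h \<in> K"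
    and y: "y \<in> {0..1}" and q: "q \<in> {0..1}" and eq: "a q = h y" "b (h y) = h y" "b q \<noteq> q"
  shows "\<exists>c\<in>commutators (PL\<^sub>o\<lparr>carrier := K\<rparr>). c y \<noteq> y"
proof -
  note PL = subgroup.mem_carrier[OF K]
  note closed = subgroup.m_closed[OF K] subgroup.m_inv_closed[OF K]
  note in01 = PL_in[OF PL]
  let ?i = "inv\<^bsub>PL\<^sub>o\<^esub> h"
  define a' where "a' = ?i \<otimes>\<^bsub>PL\<^sub>o\<^esub> a \<otimes>\<^bsub>PL\<^sub>o\<^esub> h"
  define b' where "b' = ?i \<otimes>\<^bsub>PL\<^sub>o\<^esub> b \<otimes>\<^bsub>PL\<^sub>o\<^esub> h"
  define c where "c = (a' \<otimes>\<^bsub>PL\<^sub>o\<^esub> b') \<otimes>\<^bsub>PL\<^sub>o\<^esub> inv\<^bsub>PL\<^sub>o\<^esub> (b' \<otimes>\<^bsub>PL\<^sub>o\<^esub> a')"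
  have K': "?i \<in> K" "a' \<in> K" "b' \<in> K" "c \<in> K"
    using a b h by (auto simp: a'_def b'_def c_def intro!: closed)
  have c_eq: "c \<otimes>\<^bsub>PL\<^sub>o\<^esub> (b' \<otimes>\<^bsub>PL\<^sub>o\<^esub> a') = a' \<otimes>\<^bsub>PL\<^sub>o\<^esub> b'"
    unfolding c_def using PL K' by (simp add: PL.m_assoc)
  have conj: "(?i \<otimes>\<^bsub>PL\<^sub>o\<^esub> k \<otimes>\<^bsub>PL\<^sub>o\<^esub> h) x = ?i (k (h x))" if "k \<in> K" "x \<in> {0..1}" for k x
    using PL_mult[OF PL[OF closed(1)[OF K'(1) that(1)]] PL[OF h] that(2)]
      PL_mult[OF PL[OF K'(1)] PL[OF that(1)] in01[OF h that(2)]] by simp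
  have a'x: "a' x = ?i (a (h x))" and b'x: "b' x = ?i (b (h x))" if "x \<in> {0..1}" for x
    unfolding a'_def b'_def using conj a b that by blast+
  define v where "v = ?i q"
  have v: "v \<in> {0..1}" "h v = q"
    unfolding v_def using in01[OF K'(1) q] PL_inv(2)[OF PL[OF h] q] by auto
  have hy: "h y \<in> {0..1}" using in01[OF h y] .
  have a'v: "a' v = y"
    using a'x[OF v(1)] v(2) eq(1) PL_inv(1)[OF PL[OF h] y] by simp
  have b'y: "b' y = y"
    using b'x[OF y] eq(2) PL_inv(1)[OF PL[OF h] y] by simp
  have bq: "b q \<in> {0..1}" using in01[OF b q] .
  have "c y = c ((b' \<otimes>\<^bsub>PL\<^sub>o\<^esub> a') v)"
    using PL_mult[OF PL[OF K'(3)] PL[OF K'(2)] v(1)] a'v b'y by simp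
  also have "\<dots> = (a' \<otimes>\<^bsub>PL\<^sub>o\<^esub> b') v"
    using PL_mult[OF PL[OF K'(4)] _ v(1), of "b' \<otimes>\<^bsub>PL\<^sub>o\<^esub> a'"] PL[OF K'(2)] PL[OF K'(3)] c_eq by simp
  also have "\<dots> = a' (b' v)"
    using PL_mult[OF PL[OF K'(2)] PL[OF K'(3)] v(1)] .
  finally have cy: "c y = a' (b' v)" .
  have "b' v \<noteq> v"
    using b'x[OF v(1)] v(2) PL_inv(2)[OF PL[OF h] bq] eq(3) by auto
  then have "c y \<noteq> y"
    using cy a'v PL_eq_iff[OF PL[OF K'(2)] in01[OF K'(3) v(1)] v(1)] by simp
  moreover have "c \<in> commutators (PL\<^sub>o\<lparr>carrier := K\<rparr>)"
    using K' c_eq by (auto simp: commutators_def)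
  ultimately show ?thesis by blast
qed

text \<open>With \<open>a = fall l\<close> and \<open>b = ramp m\<close>, the previous lemma needs a point of the orbit of \<open>y\<close> in
  \<open>]0, 1/4]\<close>, where \<open>b\<close> is the identity, whose preimage under \<open>a\<close> lies beyond \<open>1/4\<close>, where \<open>b\<close> moves
  everything. A point close to the supremum of the orbit below \<open>1/4\<close> has this property, since \<open>a\<close>
  strictly lowers that supremum.\<close>
lemma fall_ramp_commutators_move:
  assumes K: "subgroup K PL\<^sub>o" and irr: "irreducible_PL K"
    and l: "0 < l" "l < 1" and m: "0 < m" "m < 1" and fall: "fall l \<in> K" and ramp: "ramp m \<in> K"
    and y: "y \<in> {0<..<1}"
  shows "\<exists>c\<in>commutators (PL\<^sub>o\<lparr>carrier := K\<rparr>). c y \<noteq> y"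
proof -
  note PL = subgroup.mem_carrier[OF K]
  let ?a = "fall l"
  define S where "S = {h y |h. h \<in> K \<and> h y \<le> 1/4}"
  obtain g where "g \<in> K" "g y < 1/4"
    using irreducible_orbit_near_0[OF K irr y, of "1/4"] by auto
  then have g: "g y \<in> S" by (force simp: S_def)
  have S_pos: "0 < x" if "x \<in> S" for x
    using that PL_open_in[OF PL y] by (auto simp: S_def)
  have bdd: "bdd_above S" by (rule bdd_aboveI[of _ "1/4"]) (auto simp: S_def)
  define s where "s = Sup S"
  have s: "0 < s" "s \<le> 1/4"
    using S_pos[OF g] cSup_upper[OF g bdd] cSup_least[of S "1/4"] g unfolding s_def
    by (auto simp: S_def)
  have "?a s < s" using fall_less[OF l] s by simp
  then obtain x where "x \<in> S" "?a s < x"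
    using less_cSup_iff[OF _ bdd, of "?a s"] g unfolding s_def by blast
  then obtain h where h: "h \<in> K" "h y \<le> 1/4" "?a s < h y"
    by (auto simp: S_def)
  have hy: "h y \<in> {0<..<1}" using PL_open_in[OF PL[OF h(1)] y] .
  let ?i = "inv\<^bsub>PL\<^sub>o\<^esub> ?a"
  have i: "?i \<in> K" using subgroup.m_inv_closed[OF K fall] .
  define q where "q = ?i (h y)"
  have q: "q \<in> {0<..<1}" "?a q = h y"
    unfolding q_def using PL_open_in[OF PL[OF i] hy] PL_inv(2)[OF PL[OF fall], of "h y"] hy by auto
  have "s < q"
    using PL_less_iff[OF PL[OF fall], of s q] q h(3) s by auto
  have "1/4 < q"
  proof (rule ccontr)
    assume "\<not> 1/4 < q"
    moreover have "q = (?i \<otimes>\<^bsub>PL\<^sub>o\<^esub> h) y"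
      unfolding q_def using PL_mult[OF PL[OF i] PL[OF h(1)]] y by simp
    ultimately have "q \<in> S"
      unfolding S_def using subgroup.m_closed[OF K i h(1)] by auto
    then show False
      using cSup_upper[OF _ bdd] \<open>s < q\<close> unfolding s_def by fastforce
  qed
  then have "ramp m q \<noteq> q" "ramp m (h y) = h y"
    using ramp_greater[OF m, of q] ramp_fixed[OF m, of "h y"] q h(2) hy by auto
  then show ?thesis
    using commutator_moves[OF K fall ramp h(1), of y q] y q by auto
qed

definition gens :: "real \<Rightarrow> (real \<Rightarrow> real) set" where
  "gens \<theta> = {fall (exp (-1)), ramp (exp (-1)), ramp (exp (-\<theta>))}"

definition grp :: "real \<Rightarrow> (real \<Rightarrow> real) set" where
  "grp \<theta> = generate PL\<^sub>o (gens \<theta>)"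

abbreviation Grp :: "real \<Rightarrow> (real \<Rightarrow> real) monoid" where
  "Grp \<theta> \<equiv> PL\<^sub>o\<lparr>carrier := grp \<theta>\<rparr>"

lemma chi_hom:
  assumes "subgroup K PL\<^sub>o"
  shows "chi_l \<in> hom (PL\<^sub>o\<lparr>carrier := K\<rparr>) real_group" "chi_r \<in> hom (PL\<^sub>o\<lparr>carrier := K\<rparr>) real_group"
  using subgroup.mem_carrier[OF assms]
  by (auto simp: hom_def real_group_def chi_l_mult chi_r_mult)

context
  fixes \<theta> :: real
  assumes \<theta>: "\<theta> > 0" "\<theta> \<notin> \<rat>"
begin

lemma exp_bounds: "0 < exp (-1::real)" "exp (-1::real) < 1" "0 < exp (-\<theta>)" "exp (-\<theta>) < 1"
  using \<theta> by simp_all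

lemma gens_PL: "gens \<theta> \<subseteq> carrier PL\<^sub>o"
  unfolding gens_def using fall_PL ramp_PL exp_bounds by simp

lemma grp_subgroup: "subgroup (grp \<theta>) PL\<^sub>o"
  unfolding grp_def using PL.generate_is_subgroup[OF gens_PL] .

lemma gens_in_grp: "fall (exp (-1)) \<in> grp \<theta>" "ramp (exp (-1)) \<in> grp \<theta>" "ramp (exp (-\<theta>)) \<in> grp \<theta>"
  unfolding grp_def by (auto intro!: generate.incl simp: gens_def)

lemma group_Grp: "group (Grp \<theta>)"
  using PL.subgroup_imp_group[OF grp_subgroup] .

lemma grp_irreducible: "irreducible_PL (grp \<theta>)"
  unfolding irreducible_PL_def
proof
  assume "\<exists>x\<in>{0<..<1}. \<forall>g\<in>grp \<theta>. g x = x"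
  then obtain x where x: "x \<in> {0<..<1}" "\<And>g. g \<in> grp \<theta> \<Longrightarrow> g x = x" by blast
  show False
  proof (cases "x < 3/4")
    case True
    then show ?thesis using fall_less[OF exp_bounds(1,2), of x] x(1) x(2)[OF gens_in_grp(1)] by simp
  next
    case False
    then show ?thesis using ramp_greater[OF exp_bounds(1,2), of x] x(1) x(2)[OF gens_in_grp(2)] by simp
  qed
qed

lemma not_evasive_Grp_iff:
  assumes "t \<in> grp \<theta>"
  shows "\<not> evasive (Grp \<theta>) t \<longleftrightarrow> chi_l t > 0 \<and> chi_r t > 0"
  using evasive_if_chi_l[OF grp_subgroup grp_irreducible assms]
    evasive_if_chi_r[OF grp_subgroup grp_irreducible assms]
    not_evasive[OF grp_subgroup fall_ramp_commutators_move[OF grp_subgroup grp_irreducible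
      exp_bounds(1,2,1,2) gens_in_grp(1,2)] assms] by fastforce

lemma chi_gens:
  "chi_l (fall (exp (-1))) = -1" "chi_r (fall (exp (-1))) = 0"
  "chi_l (ramp (exp (-1))) = 0" "chi_r (ramp (exp (-1))) = -1"
  "chi_l (ramp (exp (-\<theta>))) = 0" "chi_r (ramp (exp (-\<theta>))) = -\<theta>"
  using chi_fall[OF exp_bounds(1,2)] chi_ramp[OF exp_bounds(1,2)] chi_ramp[OF exp_bounds(3,4)] by simp_all

lemma chi_values:
  assumes "g \<in> grp \<theta>"
  shows "chi_l g \<in> \<int> \<and> (\<exists>m n. chi_r g = of_int m + of_int n * \<theta>)"
proof -
  have combinations: "\<exists>m n. x = of_int m + of_int n * \<theta>" if "x \<in> {0, 1, -1, \<theta>, -\<theta>}" for x :: real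
  proof -
    have "0 = of_int 0 + of_int 0 * \<theta>" "1 = of_int 1 + of_int 0 * \<theta>" "-1 = of_int (-1) + of_int 0 * \<theta>"
      "\<theta> = of_int 0 + of_int 1 * \<theta>" "-\<theta> = of_int 0 + of_int (-1) * \<theta>" by simp_all
    then show ?thesis using that by blast
  qed
  show ?thesis
    using assms unfolding grp_def
  proof (induction rule: generate.induct)
    case one
    then show ?case
      using hom_real_one[OF group_Grp chi_hom(1)[OF grp_subgroup]] hom_real_one[OF group_Grp chi_hom(2)[OF grp_subgroup]]
      by (auto intro!: exI[of _ 0])
  next
    case (incl h)
    then have "chi_l h \<in> \<int>" "chi_r h \<in> {0, 1, -1, \<theta>, -\<theta>}"
      by (auto simp: gens_def chi_gens)
    then show ?case
      using combinations by blast
  next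
    case (inv h)
    then have h: "h \<in> grp \<theta>" unfolding grp_def by (rule generate.incl)
    have "chi_l (inv\<^bsub>PL\<^sub>o\<^esub> h) = - chi_l h" "chi_r (inv\<^bsub>PL\<^sub>o\<^esub> h) = - chi_r h"
      using hom_real_inv[OF group_Grp chi_hom(1)[OF grp_subgroup], of h]
        hom_real_inv[OF group_Grp chi_hom(2)[OF grp_subgroup], of h] h
      by (simp_all add: PL.m_inv_consistent[OF grp_subgroup h])
    moreover from inv have "- chi_l h \<in> \<int>" "- chi_r h \<in> {0, 1, -1, \<theta>, -\<theta>}"
      by (auto simp: gens_def chi_gens)
    ultimately show ?case
      using combinations by simp
  next
    case (eng g h)
    obtain m n m' n' where mn: "chi_r g = of_int m + of_int n * \<theta>" "chi_r h = of_int m' + of_int n' * \<theta>"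
      using eng by blast
    have PL: "g \<in> carrier PL\<^sub>o" "h \<in> carrier PL\<^sub>o"
      using eng subgroup.mem_carrier[OF grp_subgroup] unfolding grp_def by blast+
    have "chi_r (g \<otimes>\<^bsub>PL\<^sub>o\<^esub> h) = of_int (m + m') + of_int (n + n') * \<theta>"
      using mn chi_r_mult[OF PL] by (simp add: algebra_simps)
    then show ?case
      using eng chi_l_mult[OF PL] by (metis Ints_add)
  qed
qed

lemma chi_realized:
  "\<exists>g\<in>grp \<theta>. chi_l g = of_int k \<and> chi_r g = of_int m + of_int n * \<theta>"
proof -
  interpret G: group "Grp \<theta>" by (rule group_Grp)
  define g where "g = fall (exp (-1)) [^]\<^bsub>Grp \<theta>\<^esub> (-k) \<otimes>\<^bsub>Grp \<theta>\<^esub> ramp (exp (-1)) [^]\<^bsub>Grp \<theta>\<^esub> (-m)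
    \<otimes>\<^bsub>Grp \<theta>\<^esub> ramp (exp (-\<theta>)) [^]\<^bsub>Grp \<theta>\<^esub> (-n)"
  have in_G: "fall (exp (-1)) \<in> carrier (Grp \<theta>)" "ramp (exp (-1)) \<in> carrier (Grp \<theta>)"
    "ramp (exp (-\<theta>)) \<in> carrier (Grp \<theta>)"
    using gens_in_grp by simp_all
  have val: "\<psi> g = of_int (-k) * \<psi> (fall (exp (-1))) + of_int (-m) * \<psi> (ramp (exp (-1)))
      + of_int (-n) * \<psi> (ramp (exp (-\<theta>)))" if hom: "\<psi> \<in> hom (Grp \<theta>) real_group" for \<psi>
    unfolding g_def
    using hom_real_mult[OF hom G.m_closed[OF G.int_pow_closed[OF in_G(1)] G.int_pow_closed[OF in_G(2)]]
        G.int_pow_closed[OF in_G(3)]]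
      hom_real_mult[OF hom G.int_pow_closed[OF in_G(1)] G.int_pow_closed[OF in_G(2)]]
      hom_real_int_pow[OF group_Grp hom in_G(1)] hom_real_int_pow[OF group_Grp hom in_G(2)]
      hom_real_int_pow[OF group_Grp hom in_G(3)] by simp
  have "g \<in> carrier (Grp \<theta>)"
    unfolding g_def by (intro G.m_closed G.int_pow_closed in_G)
  then show ?thesis
    using val[OF chi_hom(1)[OF grp_subgroup]] val[OF chi_hom(2)[OF grp_subgroup]]
    by (intro bexI[of _ g]) (simp_all add: chi_gens)
qed

lemma chi_l_image: "chi_l ` grp \<theta> = \<int>"
proof
  show "\<int> \<subseteq> chi_l ` grp \<theta>"
  proof
    fix x :: real assume "x \<in> \<int>"
    then obtain k where "x = of_int k" by (auto elim: Ints_cases)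
    then show "x \<in> chi_l ` grp \<theta>" using chi_realized[of k 0 0] by force
  qed
qed (use chi_values in blast)

lemma chi_r_image: "chi_r ` grp \<theta> = {of_int m + of_int n * \<theta> |m n. True}"
proof
  show "{of_int m + of_int n * \<theta> |m n. True} \<subseteq> chi_r ` grp \<theta>"
  proof
    fix x assume "x \<in> {of_int m + of_int n * \<theta> |m n. True}"
    then obtain m n where "x = of_int m + of_int n * \<theta>" by blast
    then show "x \<in> chi_r ` grp \<theta>" using chi_realized[of 0 m n] by (metis imageI)
  qed
qed (use chi_values in blast)

lemma grp_independent: "independent_characters (grp \<theta>)"
  unfolding independent_characters_def
proof
  interpret G: group "Grp \<theta>" by (rule group_Grp)
  note PL = subgroup.mem_carrier[OF grp_subgroup]
  show "kernel (Grp \<theta>) real_group chi_l <#>\<^bsub>PL\<^sub>o\<^esub> kernel (Grp \<theta>) real_group chi_r \<subseteq> grp \<theta>"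
    using subgroup.m_closed[OF grp_subgroup] by (auto simp: set_mult_def kernel_def)
  show "grp \<theta> \<subseteq> kernel (Grp \<theta>) real_group chi_l <#>\<^bsub>PL\<^sub>o\<^esub> kernel (Grp \<theta>) real_group chi_r"
  proof
    fix t assume t: "t \<in> grp \<theta>"
    obtain k where "chi_l t = of_int k" using chi_values[OF t] by (auto elim: Ints_cases)
    then obtain v where v: "v \<in> grp \<theta>" "chi_l v = chi_l t" "chi_r v = 0"
      using chi_realized[of k 0 0] by auto
    define u where "u = t \<otimes>\<^bsub>PL\<^sub>o\<^esub> inv\<^bsub>PL\<^sub>o\<^esub> v"
    have u: "u \<in> grp \<theta>"
      unfolding u_def using t v(1) subgroup.m_closed[OF grp_subgroup] subgroup.m_inv_closed[OF grp_subgroup] by blast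
    have t_eq: "t = u \<otimes>\<^bsub>PL\<^sub>o\<^esub> v"
      unfolding u_def using PL t v(1) by (simp add: PL.m_assoc)
    have "chi_l u = 0"
      using chi_l_mult[OF PL[OF u] PL[OF v(1)]] t_eq v(2) by simp
    then show "t \<in> kernel (Grp \<theta>) real_group chi_l <#>\<^bsub>PL\<^sub>o\<^esub> kernel (Grp \<theta>) real_group chi_r"
      using t_eq u v by (auto simp: set_mult_def kernel_def real_group_def)
  qed
qed

end

text \<open>Pulling back the characters along \<open>\<phi>\<close> yields a second pair with the same open quadrant. If the two
  were exchanged, \<open>\<int> + \<int>\<theta>\<close> would be a multiple of a subgroup of \<open>\<int>\<close> and \<open>\<theta>\<close> rational. Otherwise
  \<open>\<chi>\<^sub>l\<close> is multiplied by a positive factor that maps \<open>\<int>\<close> onto \<open>\<int>\<close>.\<close>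
lemma iso_preserves_characters:
  assumes \<theta>: "\<theta> > 0" "\<theta> \<notin> \<rat>" and \<eta>: "\<eta> > 0" "\<eta> \<notin> \<rat>" and iso: "\<phi> \<in> iso (Grp \<theta>) (Grp \<eta>)"
  shows "(\<forall>t\<in>grp \<theta>. chi_l (\<phi> t) = chi_l t) \<and> (\<exists>s>0. \<forall>t\<in>grp \<theta>. chi_r (\<phi> t) = s * chi_r t)"
proof -
  have hom: "\<phi> \<in> hom (Grp \<theta>) (Grp \<eta>)" and im: "\<phi> ` grp \<theta> = grp \<eta>"
    using iso by (auto simp: iso_def bij_betw_def)
  have chi_phi: "(\<lambda>t. chi_l (\<phi> t)) \<in> hom (Grp \<theta>) real_group" "(\<lambda>t. chi_r (\<phi> t)) \<in> hom (Grp \<theta>) real_group"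
    using hom_compose[OF hom chi_hom(1)[OF grp_subgroup[OF \<eta>]]] hom_compose[OF hom chi_hom(2)[OF grp_subgroup[OF \<eta>]]]
    by (simp_all add: comp_def)
  have evasive: "evasive (Grp \<eta>) (\<phi> t) \<longleftrightarrow> evasive (Grp \<theta>) t" if t: "t \<in> grp \<theta>" for t
  proof
    show "evasive (Grp \<theta>) t \<Longrightarrow> evasive (Grp \<eta>) (\<phi> t)"
      using evasive_iso[OF group_Grp[OF \<theta>] group_Grp[OF \<eta>] iso] t by simp
    assume "evasive (Grp \<eta>) (\<phi> t)"
    then have "evasive (Grp \<theta>) (inv_into (grp \<theta>) \<phi> (\<phi> t))"
      using evasive_iso[OF group_Grp[OF \<eta>] group_Grp[OF \<theta>] group.iso_set_sym[OF group_Grp[OF \<theta>] iso], of "\<phi> t"] t im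
      by auto
    then show "evasive (Grp \<theta>) t"
      using iso t by (simp add: iso_def bij_betw_def inv_into_f_f)
  qed
  have cone: "chi_l t > 0 \<and> chi_r t > 0 \<longleftrightarrow> chi_l (\<phi> t) > 0 \<and> chi_r (\<phi> t) > 0" if "t \<in> carrier (Grp \<theta>)" for t
    using not_evasive_Grp_iff[OF \<theta>] not_evasive_Grp_iff[OF \<eta>] evasive that im by fastforce
  obtain a where a: "a \<in> grp \<theta>" "chi_l a = 1" "chi_r a = 0"
    using chi_realized[OF \<theta>, of 1 0 0] by auto
  obtain b where b: "b \<in> grp \<theta>" "chi_l b = 0" "chi_r b = 1"
    using chi_realized[OF \<theta>, of 0 1 0] by auto
  obtain c where c: "c \<in> grp \<theta>" "chi_r c = \<theta>"
    using chi_realized[OF \<theta>, of 0 0 1] by auto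
  obtain a' where a': "a' \<in> grp \<theta>" "chi_l (\<phi> a') = 1"
    using chi_realized[OF \<eta>, of 1 0 0] im by (metis imageE of_int_1)
  have Z: "chi_l (\<phi> t) \<in> \<int>" if "t \<in> grp \<theta>" for t
    using chi_values[OF \<eta>, of "\<phi> t"] im that by blast
  have "(\<exists>r>0. \<exists>s>0. \<forall>t\<in>carrier (Grp \<theta>). chi_l (\<phi> t) = r * chi_l t \<and> chi_r (\<phi> t) = s * chi_r t) \<or>
        (\<exists>r>0. \<exists>s>0. \<forall>t\<in>carrier (Grp \<theta>). chi_l (\<phi> t) = r * chi_r t \<and> chi_r (\<phi> t) = s * chi_l t)"
    using same_positive_cone[OF group_Grp[OF \<theta>] chi_hom[OF grp_subgroup[OF \<theta>]] chi_phi _ _ _ _ _ _ cone, of a b] a b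
    by simp
  then show ?thesis
  proof
    assume "\<exists>r>0. \<exists>s>0. \<forall>t\<in>carrier (Grp \<theta>). chi_l (\<phi> t) = r * chi_r t \<and> chi_r (\<phi> t) = s * chi_l t"
    then obtain r where r: "r > 0" "\<And>t. t \<in> grp \<theta> \<Longrightarrow> chi_l (\<phi> t) = r * chi_r t" by auto
    have "r \<in> \<int>" "r * \<theta> \<in> \<int>"
      using Z[OF b(1)] Z[OF c(1)] r(2)[OF b(1)] r(2)[OF c(1)] b c by simp_all
    then have "r * \<theta> / r \<in> \<rat>"
      using Ints_subset_Rats by (intro Rats_divide) auto
    then show ?thesis using r(1) \<theta>(2) by simp
  next
    assume "\<exists>r>0. \<exists>s>0. \<forall>t\<in>carrier (Grp \<theta>). chi_l (\<phi> t) = r * chi_l t \<and> chi_r (\<phi> t) = s * chi_r t"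
    then obtain r s where rs: "r > 0" "s > 0" "\<And>t. t \<in> grp \<theta> \<Longrightarrow> chi_l (\<phi> t) = r * chi_l t"
      "\<And>t. t \<in> grp \<theta> \<Longrightarrow> chi_r (\<phi> t) = s * chi_r t" by auto
    obtain i where i: "r = of_int i"
      using Z[OF a(1)] rs(3)[OF a(1)] a(2) by (auto elim: Ints_cases)
    obtain j where j: "chi_l a' = of_int j"
      using chi_values[OF \<theta> a'(1)] by (auto elim: Ints_cases)
    have "(of_int (i * j) :: real) = of_int 1"
      using rs(3)[OF a'(1)] a'(2) i j by simp
    then have "i * j = 1" by (simp only: of_int_eq_iff)
    then have "r = 1" using i rs(1) by (auto simp: zmult_eq_1_iff)
    then show ?thesis using rs by auto
  qed
qed

text \<open>If \<open>\<int> + \<int>\<eta> = s (\<int> + \<int>\<theta>)\<close>, then \<open>s\<close> and \<open>s\<theta>\<close> are integral combinations of 1 and \<open>\<eta>\<close>; eliminating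
  \<open>s\<close> expresses \<open>\<eta>\<close> as a fractional linear function of \<open>\<theta>\<close> with integral coefficients.\<close>
lemma countable_isomorphic:
  assumes \<theta>: "\<theta> > 0" "\<theta> \<notin> \<rat>"
  shows "countable {\<eta>. \<eta> > 0 \<and> \<eta> \<notin> \<rat> \<and> Grp \<theta> \<cong> Grp \<eta>}"
proof -
  have "\<eta> \<in> (\<lambda>(p, m, q, n). (of_int p - of_int m * \<theta>) / (of_int n * \<theta> - of_int q)) ` (UNIV :: (int \<times> int \<times> int \<times> int) set)"
    if \<eta>: "\<eta> > 0" "\<eta> \<notin> \<rat>" and iso: "Grp \<theta> \<cong> Grp \<eta>" for \<eta>
  proof -
    obtain \<phi> where \<phi>: "\<phi> \<in> iso (Grp \<theta>) (Grp \<eta>)"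
      using iso unfolding is_iso_def by blast
    then obtain s where s: "s > 0" "\<And>t. t \<in> grp \<theta> \<Longrightarrow> chi_r (\<phi> t) = s * chi_r t"
      using iso_preserves_characters[OF \<theta> \<eta>] by blast
    have val: "\<exists>m n. s * chi_r t = of_int m + of_int n * \<eta>" if "t \<in> grp \<theta>" for t
      using chi_values[OF \<eta>, of "\<phi> t"] s(2)[OF that] \<phi> that by (auto simp: iso_def bij_betw_def)
    obtain m n where mn: "s = of_int m + of_int n * \<eta>"
      using val chi_realized[OF \<theta>, of 0 1 0] by force
    obtain p q where pq: "s * \<theta> = of_int p + of_int q * \<eta>"
      using val chi_realized[OF \<theta>, of 0 0 1] by force
    have eq: "\<eta> * (of_int n * \<theta> - of_int q) = of_int p - of_int m * \<theta>"
      using pq mn by (simp add: algebra_simps)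
    have "of_int n * \<theta> - of_int q \<noteq> 0"
    proof
      assume 0: "of_int n * \<theta> - of_int q = 0"
      then have q: "of_int (-q) + of_int n * \<theta> = 0" and p: "of_int p + of_int (-m) * \<theta> = 0"
        using eq by auto
      have "n = 0" "m = 0"
        using int_combination_irrational_eq_0[OF \<theta>(2) q] int_combination_irrational_eq_0[OF \<theta>(2) p] by simp_all
      then show False using mn s(1) by simp
    qed
    then have "\<eta> = (of_int p - of_int m * \<theta>) / (of_int n * \<theta> - of_int q)"
      using eq by (simp add: eq_divide_eq)
    then show ?thesis
      by (intro image_eqI[of _ _ "(p, m, q, n)"]) auto
  qed
  then show ?thesis
    by (intro countable_subset[OF _ countable_image[OF countableI_type]]) blast
qed

section \<open>A continuum of isomorphism classes\<close>

theorem mainTheorem3: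
  shows "\<exists>\<G> :: (real \<Rightarrow> real) set set.
    pairwise (\<lambda>G H. \<not> (PL\<^sub>o\<lparr>carrier := G\<rparr> \<cong> PL\<^sub>o\<lparr>carrier := H\<rparr>)) \<G> \<and>
    (\<forall>G\<in>\<G>. subgroup G PL\<^sub>o \<and> irreducible_PL G \<and>
       (\<exists>a\<in>carrier PL\<^sub>o. \<exists>b\<in>carrier PL\<^sub>o. \<exists>c\<in>carrier PL\<^sub>o. G = generate PL\<^sub>o {a, b, c})) \<and>
    (\<forall>G\<in>\<G>. independent_characters G \<and> ab_rank (chi_l ` G) = 1 \<and> ab_rank (chi_r ` G) = 2) \<and>
    (\<forall>G\<in>\<G>. \<forall>\<alpha>\<in>auto (PL\<^sub>o\<lparr>carrier := G\<rparr>). \<forall>g\<in>G. chi_l (\<alpha> g) = chi_l g) \<and>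
    \<G> \<approx> (UNIV :: real set)"
proof -
  define I where "I = {\<theta>::real. \<theta> > 0 \<and> \<theta> \<notin> \<rat>}"
  define rep where "rep \<theta> = (SOME \<eta>. \<eta> \<in> I \<and> Grp \<theta> \<cong> Grp \<eta>)" for \<theta>
  have rep: "rep \<theta> \<in> I" "Grp \<theta> \<cong> Grp (rep \<theta>)" if "\<theta> \<in> I" for \<theta>
    using someI[of "\<lambda>\<eta>. \<eta> \<in> I \<and> Grp \<theta> \<cong> Grp \<eta>" \<theta>] that by (auto simp: rep_def)
  have sym: "Grp \<eta> \<cong> Grp \<theta>" if "\<theta> \<in> I" "Grp \<theta> \<cong> Grp \<eta>" for \<theta> \<eta>
    using group.iso_sym[OF group_Grp that(2)] that(1) by (simp add: I_def)
  have rep_eq: "rep \<theta> = rep \<eta>" if "\<theta> \<in> I" "\<eta> \<in> I" "Grp \<theta> \<cong> Grp \<eta>" for \<theta> \<eta>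
  proof -
    have "Grp \<theta> \<cong> Grp \<zeta> \<longleftrightarrow> Grp \<eta> \<cong> Grp \<zeta>" for \<zeta>
      using sym that iso_trans by blast
    then show ?thesis by (simp add: rep_def)
  qed
  define \<G> where "\<G> = grp ` rep ` I"
  have I: "\<theta> > 0" "\<theta> \<notin> \<rat>" if "\<theta> \<in> rep ` I" for \<theta>
    using that rep(1) by (auto simp: I_def)
  have grp_of: "\<exists>\<theta>. \<theta> > 0 \<and> \<theta> \<notin> \<rat> \<and> G = grp \<theta>" if G: "G \<in> \<G>" for G
  proof -
    obtain \<theta> where "\<theta> \<in> rep ` I" "G = grp \<theta>" using G unfolding \<G>_def by (rule imageE)
    then show ?thesis using I by blast
  qed
  have distinct: "\<not> Grp \<theta> \<cong> Grp \<eta>" if \<theta>\<eta>: "\<theta> \<in> rep ` I" "\<eta> \<in> rep ` I" "\<theta> \<noteq> \<eta>" for \<theta> \<eta>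
  proof
    assume iso: "Grp \<theta> \<cong> Grp \<eta>"
    obtain \<theta>' where *: "\<theta>' \<in> I" "\<theta> = rep \<theta>'" using \<theta>\<eta>(1) by blast
    obtain \<eta>' where **: "\<eta>' \<in> I" "\<eta> = rep \<eta>'" using \<theta>\<eta>(2) by blast
    have "Grp \<theta>' \<cong> Grp \<theta>" "Grp \<eta> \<cong> Grp \<eta>'"
      using rep(2) sym * ** by auto
    then have "Grp \<theta>' \<cong> Grp \<eta>'"
      using iso iso_trans by blast
    then show False using rep_eq * ** \<theta>\<eta>(3) by blast
  qed
  have "pairwise (\<lambda>G H. \<not> (PL\<^sub>o\<lparr>carrier := G\<rparr> \<cong> PL\<^sub>o\<lparr>carrier := H\<rparr>)) \<G>"
    unfolding \<G>_def by (intro pairwise_imageI) (use distinct in auto)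
  moreover have "\<forall>G\<in>\<G>. subgroup G PL\<^sub>o \<and> irreducible_PL G \<and>
       (\<exists>a\<in>carrier PL\<^sub>o. \<exists>b\<in>carrier PL\<^sub>o. \<exists>c\<in>carrier PL\<^sub>o. G = generate PL\<^sub>o {a, b, c})"
  proof
    fix G assume "G \<in> \<G>"
    then obtain \<theta> where \<theta>: "\<theta> > 0" "\<theta> \<notin> \<rat>" "G = grp \<theta>" using grp_of by blast
    show "subgroup G PL\<^sub>o \<and> irreducible_PL G \<and>
       (\<exists>a\<in>carrier PL\<^sub>o. \<exists>b\<in>carrier PL\<^sub>o. \<exists>c\<in>carrier PL\<^sub>o. G = generate PL\<^sub>o {a, b, c})"
      using grp_subgroup[OF \<theta>(1,2)] grp_irreducible[OF \<theta>(1,2)] gens_PL[OF \<theta>(1,2)]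
      unfolding \<theta>(3) grp_def gens_def by blast
  qed
  moreover have "\<forall>G\<in>\<G>. independent_characters G \<and> ab_rank (chi_l ` G) = 1 \<and> ab_rank (chi_r ` G) = 2"
  proof
    fix G assume "G \<in> \<G>"
    then obtain \<theta> where \<theta>: "\<theta> > 0" "\<theta> \<notin> \<rat>" "G = grp \<theta>" using grp_of by blast
    show "independent_characters G \<and> ab_rank (chi_l ` G) = 1 \<and> ab_rank (chi_r ` G) = 2"
      unfolding \<theta>(3) chi_l_image[OF \<theta>(1,2)] chi_r_image[OF \<theta>(1,2)]
      using grp_independent[OF \<theta>(1,2)] ab_rank_Ints ab_rank_int_combinations[OF \<theta>(2)] by blast
  qed
  moreover have "\<forall>G\<in>\<G>. \<forall>\<alpha>\<in>auto (PL\<^sub>o\<lparr>carrier := G\<rparr>). \<forall>g\<in>G. chi_l (\<alpha> g) = chi_l g"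
  proof (intro ballI)
    fix G \<alpha> g assume G: "G \<in> \<G>" and \<alpha>: "\<alpha> \<in> auto (PL\<^sub>o\<lparr>carrier := G\<rparr>)" and g: "g \<in> G"
    obtain \<theta> where \<theta>: "\<theta> > 0" "\<theta> \<notin> \<rat>" "G = grp \<theta>" using grp_of[OF G] by blast
    have "\<alpha> \<in> iso (Grp \<theta>) (Grp \<theta>)"
      using \<alpha> \<theta>(3) by (simp add: auto_def iso_def Bij_def)
    then show "chi_l (\<alpha> g) = chi_l g"
      using iso_preserves_characters[OF \<theta>(1,2) \<theta>(1,2)] g \<theta>(3) by blast
  qed
  moreover have "\<G> \<approx> (UNIV :: real set)"
  proof (rule lepoll_antisym)
    have inj: "inj_on grp (rep ` I)"
      using distinct by (intro inj_onI) (metis iso_refl)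
    show "\<G> \<lesssim> (UNIV :: real set)"
      unfolding \<G>_def using inj by (simp add: subset_imp_lepoll)
    \<comment> \<open>The exponential function parametrizes the positive numbers by all reals; 0 collects the countably
      many rational values.\<close>
    define f where "f x = (if exp x \<in> \<rat> then 0 else rep (exp x))" for x :: real
    have "countable {x. f x = f a}" for a
    proof -
      define C where "C = (if exp a \<in> \<rat> then \<rat> else {\<eta>. \<eta> > 0 \<and> \<eta> \<notin> \<rat> \<and> Grp (f a) \<cong> Grp \<eta>})"
      have C: "countable C"
        unfolding C_def using countable_isomorphic[of "f a"] I[of "f a"] by (auto simp: f_def I_def countable_rat)
      have "exp x \<in> C" if fx: "f x = f a" for x
      proof -
        have f_zero: "f z = 0 \<longleftrightarrow> exp z \<in> \<rat>" for z
          using rep(1)[of "exp z"] by (auto simp: f_def I_def)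
        show ?thesis
        proof (cases "exp x \<in> \<rat>")
          case True
          then show ?thesis using f_zero[of x] f_zero[of a] fx by (simp add: C_def)
        next
          case False
          then have x: "exp x \<in> I" and "exp a \<notin> \<rat>" and "f a = rep (exp x)"
            using f_zero[of x] f_zero[of a] fx by (auto simp: f_def I_def)
          then show ?thesis
            using sym[OF x rep(2)[OF x]] by (simp add: C_def I_def)
        qed
      qed
      then have "countable (exp ` {x. f x = f a})"
        by (intro countable_subset[OF _ C]) auto
      then show ?thesis
        by (rule countable_image_inj_on) (simp add: inj_on_def)
    qed
    then have "(UNIV :: real set) \<lesssim> range f"
      using uncountable_UNIV_real by (intro lepoll_image_countable_fibres) simp_all
    also have "range f \<lesssim> insert 0 (rep ` I)"
      by (intro subset_imp_lepoll) (auto simp: f_def I_def)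
    finally have le: "(UNIV :: real set) \<lesssim> insert 0 (rep ` I)" .
    have "infinite (rep ` I)"
    proof
      assume "finite (rep ` I)"
      then have "countable (insert 0 (rep ` I))" by (simp add: countable_finite)
      then show False using countable_lepoll[OF _ le] uncountable_UNIV_real by simp
    qed
    from lepoll_trans2[OF le infinite_insert_eqpoll[OF this]]
    have "(UNIV :: real set) \<lesssim> rep ` I" .
    also have "rep ` I \<lesssim> \<G>"
      unfolding \<G>_def using inj by simp
    finally show "(UNIV :: real set) \<lesssim> \<G>" .
  qed
  ultimately show ?thesis by (intro exI[of _ \<G>] conjI)
qed

end
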